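(* Let $g\ge1$ and fix an admissible decomposition $\Sigma$ of $\Omega_g^{\rm rt}$. (i) The tropical Siegel space ${}^\Sigma\mathbb H_g^{tr}$ (resp. the pure tropical Siegel space ${}^\Sigma\mathbb H_g^{tr,p}$) is a stacky fan (resp. an ideal stacky fan) parametrizing marked tropical p.p. abelian varieties (resp. marked pure tropical p.p. abelian varieties) of dimension $g$. (ii) The map $$\Phi:{}^\Sigma\mathbb H_g^{tr}\longrightarrow\Omega_g^{\rm rt},\qquad (V/\Lambda,Q,\phi)\mapsto\phi^*(Q)$$ is a continuous bijection which restricts to a homeomorphism between ${}^\Sigma\mathbb H_g^{tr,p}$ and $\Omega_g$.
   Context: In the space $\mathbb R^{\binom{g+1}2}$ of quadratic forms on $\mathbb R^g$ (symmetric $g\times g$ matrices, with lattice the integral symmetric matrices), $\Omega_g$ is the cone of positive definite forms and $\Omega_g^{\rm rt}$ is the cone of positive semi-definite forms whose null space has a basis in $\mathbb Q^g$, with the subspace topologies. An admissible decomposition $\Sigma$ of $\Omega_g^{\rm rt}$ is a collection of rational polyhedral cones contained in $\Omega_g^{\rm rt}$ such that: faces of cones of $\Sigma$ are in $\Sigma$; the intersection of two cones of $\Sigma$ is a face of both; if $\sigma\in\Sigma$ and $M\in\operatorname{GL}_g(\mathbb Z)$ then $M\sigma M^t\in\Sigma$; there are finitely many $\operatorname{GL}_g(\mathbb Z)$-orbits of cones in $\Sigma$; and $\bigcup_{\sigma\in\Sigma}\sigma=\Omega_g^{\rm rt}$. Put $\Sigma_{|\Omega_g}=\{\sigma\cap\Omega_g:\sigma\in\Sigma,\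 \sigma\cap\Omega_g\neq\emptyset\}$; these are ideal cones (rational polyhedral cones with some faces removed). ${}^\Sigma\mathbb H_g^{tr}$ (resp. ${}^\Sigma\mathbb H_g^{tr,p}$) is the topological space obtained from the disjoint union of the cones of $\Sigma$ (resp. of $\Sigma_{|\Omega_g}$) by gluing along all face inclusions, with the quotient topology. In general, a space $X=(\coprod\sigma_i)/\!\sim$ glued from ideal cones along lattice-preserving linear identifications of cones with faces of other cones is an ideal stacky fan if, as sets, $X=\coprod(\sigma_i^0/\!\sim)$ ($\sigma_i^0$ the relative interior); it is a stacky fan if all cones are closed. A tropical p.p. abelian variety of dimension $g$ is $(V/\Lambda,Q)$ with $V$ a $g$-dimensional real vector space, $\Lambda\subset V$ a full-dimensional lattice, and $Q$ a positive semi-definite quadratic form on $V$ whose null space has a basis in $\Lambda\otimes\mathbb Q$; it is pure if $Q$ is positive definite. A marking is a linear isomorphism $\phi:\mathbb R^g\to V$ with $\phi(\mathbb Z^g)=\Lambda$. Marked objects are considered up to isomorphism (linear isomorphisms respecting lattices, forms and markings); thus a marked object is determined by $\phi^*(Q)\in\Omega_g^{\rm rt}$, and "parametrizing" means that the point of ${}^\Sigma\mathbb H_g^{tr}$ given by a form $Q'$ in a cone of $\Sigma$ corresponds to the isomorphism class of $(\mathbb R^g/\mathbb Z^g,Q',\mathrm{id})$. *)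

theory Defs
  imports "HOL-Analysis.Analysis"
begin

section \<open>Quotient topologies and glued spaces\<close>

text \<open>Points of the quotient are the equivalence classes themselves.\<close>

definition quotient_topology :: "'a topology \<Rightarrow> ('a \<times> 'a) set \<Rightarrow> 'a set topology" where
  "quotient_topology X r =
     topology (\<lambda>U. U \<subseteq> topspace X // r \<and> openin X {x \<in> topspace X. r `` {x} \<in> U})"

lemma istopology_quotient:
  "istopology (\<lambda>U. U \<subseteq> topspace X // r \<and> openin X {x \<in> topspace X. r `` {x} \<in> U})"
proof -
  have Int: "{x \<in> topspace X. r `` {x} \<in> S \<inter> T} =
      {x \<in> topspace X. r `` {x} \<in> S} \<inter> {x \<in> topspace X. r `` {x} \<in> T}" for S T
    by blast
  have Un: "{x \<in> topspace X. r `` {x} \<in> \<Union>K} = (\<Union>U\<in>K. {x \<in> topspace X. r `` {x} \<in> U})" for K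
    by blast
  show ?thesis
    unfolding istopology_def Int Un by blast
qed

lemma openin_quotient_topology:
  "openin (quotient_topology X r) U \<longleftrightarrow>
     U \<subseteq> topspace X // r \<and> openin X {x \<in> topspace X. r `` {x} \<in> U}"
  unfolding quotient_topology_def by (simp add: topology_inverse' istopology_quotient)

text \<open>A family of cones \<open>\<sigma> i\<close> (\<open>i \<in> I\<close>) is glued along a set \<open>K\<close> of triples \<open>(i, j, f)\<close>; such a
  triple identifies \<open>x\<close> in the cone \<open>\<sigma> i\<close> with \<open>f x\<close> in the cone \<open>\<sigma> j\<close>.\<close>

definition glue_rel ::
    "'i set \<Rightarrow> ('i \<Rightarrow> 'a set) \<Rightarrow> ('i \<times> 'i \<times> ('a \<Rightarrow> 'a)) set \<Rightarrow> (('i \<times> 'a) \<times> ('i \<times> 'a)) set" where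
  "glue_rel I \<sigma> K =
     (let R = {((i, x), (j, f x)) |i j f x. (i, j, f) \<in> K \<and> x \<in> \<sigma> i}
      in (R \<union> R\<inverse>)\<^sup>* \<inter> (Sigma I \<sigma> \<times> Sigma I \<sigma>))"

definition glued_space ::
    "'i set \<Rightarrow> ('i \<Rightarrow> 'a::topological_space set) \<Rightarrow> ('i \<times> 'i \<times> ('a \<Rightarrow> 'a)) set
      \<Rightarrow> ('i \<times> 'a) set topology" where
  "glued_space I \<sigma> K =
     quotient_topology (sum_topology (\<lambda>i. top_of_set (\<sigma> i)) I) (glue_rel I \<sigma> K)"


section \<open>Cones and stacky fans\<close>

text \<open>The argument \<open>L\<close> is the lattice of the ambient space. The cone generated by the empty set
  is \<open>{0}\<close>.\<close>

definition rational_polyhedral_cone :: "'a::real_vector set \<Rightarrow> 'a set \<Rightarrow> bool" where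
  "rational_polyhedral_cone L C \<longleftrightarrow> (\<exists>S. finite S \<and> S \<subseteq> L \<and> C = convex_cone hull S)"

definition ideal_cone :: "'a::real_vector set \<Rightarrow> 'a set \<Rightarrow> bool" where
  "ideal_cone L X \<longleftrightarrow> X \<noteq> {} \<and>
     (\<exists>C F. rational_polyhedral_cone L C \<and> (\<forall>T\<in>F. T face_of C) \<and> X = C - \<Union>F)"

definition lattice_preserving_on :: "'a::real_vector set \<Rightarrow> 'a set \<Rightarrow> ('a \<Rightarrow> 'a) \<Rightarrow> bool" where
  "lattice_preserving_on L X f \<longleftrightarrow>
     linear f \<and> inj_on f (span X) \<and> f ` (L \<inter> span X) = L \<inter> span (f ` X)"

text \<open>The last condition says that the space is, as a set, the disjoint union of the
  \<open>\<sigma>\<^sub>i\<^sup>0/\<sim>\<close>: the map sending a class of points of the relative interior of \<open>\<sigma> i\<close> to the class in the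
  glued space that contains it is a bijection from the disjoint union over \<open>i\<close>.\<close>

definition ideal_stacky_fan ::
    "'a::euclidean_space set \<Rightarrow> 'i set \<Rightarrow> ('i \<Rightarrow> 'a set) \<Rightarrow> ('i \<times> 'i \<times> ('a \<Rightarrow> 'a)) set \<Rightarrow> bool" where
  "ideal_stacky_fan L I \<sigma> K \<longleftrightarrow>
     (\<forall>i\<in>I. ideal_cone L (\<sigma> i)) \<and>
     (\<forall>(i, j, f)\<in>K. i \<in> I \<and> j \<in> I \<and> lattice_preserving_on L (\<sigma> i) f \<and> f ` \<sigma> i face_of \<sigma> j) \<and>
     bij_betw (\<lambda>(i, c). glue_rel I \<sigma> K `` ({i} \<times> c))
       (SIGMA i:I. rel_interior (\<sigma> i) //
          {(x, y). x \<in> rel_interior (\<sigma> i) \<and> y \<in> rel_interior (\<sigma> i) \<and>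
                   ((i, x), (i, y)) \<in> glue_rel I \<sigma> K})
       (topspace (glued_space I \<sigma> K))"

definition stacky_fan ::
    "'a::euclidean_space set \<Rightarrow> 'i set \<Rightarrow> ('i \<Rightarrow> 'a set) \<Rightarrow> ('i \<times> 'i \<times> ('a \<Rightarrow> 'a)) set \<Rightarrow> bool" where
  "stacky_fan L I \<sigma> K \<longleftrightarrow> ideal_stacky_fan L I \<sigma> K \<and> (\<forall>i\<in>I. closed (\<sigma> i))"


section \<open>Quadratic forms and admissible decompositions\<close>

text \<open>A quadratic form on \<open>\<real>\<^sup>g\<close> is identified with its symmetric matrix \<open>A\<close>, the form being
  \<open>x \<bullet> (A *v x)\<close>. Here \<open>g\<close> is \<open>CARD('n)\<close>, which is at least 1.\<close>

definition integral_vectors :: "(real^'n) set" where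
  "integral_vectors = {x. \<forall>i. x $ i \<in> \<int>}"

definition rational_vectors :: "(real^'n) set" where
  "rational_vectors = {x. \<forall>i. x $ i \<in> \<rat>}"

definition integral_matrices :: "(real^'n^'n) set" where
  "integral_matrices = {A. \<forall>i j. A $ i $ j \<in> \<int>}"

definition symmetric_matrices :: "(real^'n^'n) set" where
  "symmetric_matrices = {A. transpose A = A}"

definition symmetric_lattice :: "(real^'n^'n) set" where
  "symmetric_lattice = symmetric_matrices \<inter> integral_matrices"

definition pos_def_cone :: "(real^'n^'n) set" where
  "pos_def_cone = {A \<in> symmetric_matrices. \<forall>x. x \<noteq> 0 \<longrightarrow> 0 < x \<bullet> (A *v x)}"

definition rational_closure_cone :: "(real^'n^'n) set" where
  "rational_closure_cone =
     {A \<in> symmetric_matrices. (\<forall>x. 0 \<le> x \<bullet> (A *v x)) \<and>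
        (\<exists>B. B \<subseteq> rational_vectors \<and> independent B \<and> span B = {x. A *v x = 0})}"

definition GL_int :: "(real^'n^'n) set" where
  "GL_int = {M \<in> integral_matrices. \<exists>N\<in>integral_matrices. M ** N = mat 1 \<and> N ** M = mat 1}"

definition GL_act :: "real^'n^'n \<Rightarrow> (real^'n^'n) set \<Rightarrow> (real^'n^'n) set" where
  "GL_act M \<sigma> = (\<lambda>A. M ** A ** transpose M) ` \<sigma>"

text \<open>In the library the empty set is a face of every convex set; here faces are nonempty.\<close>

definition admissible_decomposition :: "(real^'n^'n) set set \<Rightarrow> bool" where
  "admissible_decomposition \<Sigma> \<longleftrightarrow>
     (\<forall>\<sigma>\<in>\<Sigma>. rational_polyhedral_cone symmetric_lattice \<sigma> \<and> \<sigma> \<subseteq> rational_closure_cone) \<and>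
     (\<forall>\<sigma>\<in>\<Sigma>. \<forall>\<tau>. \<tau> face_of \<sigma> \<and> \<tau> \<noteq> {} \<longrightarrow> \<tau> \<in> \<Sigma>) \<and>
     (\<forall>\<sigma>\<in>\<Sigma>. \<forall>\<tau>\<in>\<Sigma>. \<sigma> \<inter> \<tau> face_of \<sigma> \<and> \<sigma> \<inter> \<tau> face_of \<tau>) \<and>
     (\<forall>\<sigma>\<in>\<Sigma>. \<forall>M\<in>GL_int. GL_act M \<sigma> \<in> \<Sigma>) \<and>
     finite ((\<lambda>\<sigma>. {GL_act M \<sigma> |M. M \<in> GL_int}) ` \<Sigma>) \<and>
     \<Union>\<Sigma> = rational_closure_cone"


section \<open>The tropical Siegel spaces\<close>

definition pure_restriction :: "(real^'n^'n) set set \<Rightarrow> (real^'n^'n) set set" where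
  "pure_restriction \<Sigma> = {\<sigma> \<inter> pos_def_cone |\<sigma>. \<sigma> \<in> \<Sigma> \<and> \<sigma> \<inter> pos_def_cone \<noteq> {}}"

definition face_inclusions :: "'a::real_vector set set \<Rightarrow> ('a set \<times> 'a set \<times> ('a \<Rightarrow> 'a)) set" where
  "face_inclusions C = {(\<tau>, \<sigma>, \<lambda>x. x) |\<tau> \<sigma>. \<tau> \<in> C \<and> \<sigma> \<in> C \<and> \<tau> face_of \<sigma>}"

definition tropical_siegel ::
    "(real^'n^'n) set set \<Rightarrow> ((real^'n^'n) set \<times> (real^'n^'n)) set topology" where
  "tropical_siegel \<Sigma> = glued_space \<Sigma> (\<lambda>\<sigma>. \<sigma>) (face_inclusions \<Sigma>)"

definition pure_tropical_siegel ::
    "(real^'n^'n) set set \<Rightarrow> ((real^'n^'n) set \<times> (real^'n^'n)) set topology" where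
  "pure_tropical_siegel \<Sigma> =
     glued_space (pure_restriction \<Sigma>) (\<lambda>\<sigma>. \<sigma>) (face_inclusions (pure_restriction \<Sigma>))"

text \<open>The map from the pure space to the full space induced by the inclusions
  \<open>\<sigma> \<inter> \<Omega>\<^sub>g \<subseteq> \<sigma>\<close>.\<close>

definition pure_inclusion ::
    "(real^'n^'n) set set \<Rightarrow> ((real^'n^'n) set \<times> (real^'n^'n)) set
      \<Rightarrow> ((real^'n^'n) set \<times> (real^'n^'n)) set" where
  "pure_inclusion \<Sigma> p =
     (THE q. q \<in> topspace (tropical_siegel \<Sigma>) \<and>
        (\<exists>\<sigma>\<in>\<Sigma>. \<exists>A. (\<sigma> \<inter> pos_def_cone, A) \<in> p \<and> (\<sigma>, A) \<in> q))"


section \<open>Tropical principally polarized abelian varieties\<close>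

definition lattice_in :: "'v::real_vector set \<Rightarrow> 'v set \<Rightarrow> bool" where
  "lattice_in V \<Lambda> \<longleftrightarrow>
     (\<exists>B. finite B \<and> independent B \<and> span B = V \<and>
        \<Lambda> = {(\<Sum>b\<in>B. of_int (c b) *\<^sub>R b) |c::'v \<Rightarrow> int. True})"

definition quadratic_form_on :: "'v::real_vector set \<Rightarrow> ('v \<Rightarrow> real) \<Rightarrow> bool" where
  "quadratic_form_on V Q \<longleftrightarrow> (\<exists>\<beta>. bilinear \<beta> \<and> (\<forall>x\<in>V. Q x = \<beta> x x))"

text \<open>The null space is the radical of the polar form \<open>Q (x + y) - Q x - Q y\<close>.\<close>

definition null_space_on :: "'v::real_vector set \<Rightarrow> ('v \<Rightarrow> real) \<Rightarrow> 'v set" where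
  "null_space_on V Q = {x \<in> V. \<forall>y\<in>V. Q (x + y) - Q x - Q y = 0}"

text \<open>The real vector space \<open>V\<close> is a subspace of an arbitrary real vector space \<open>'v\<close>; only the
  restriction of the form to \<open>V\<close> is relevant.\<close>

record 'v tppav =
  tp_space :: "'v set"
  tp_lattice :: "'v set"
  tp_form :: "'v \<Rightarrow> real"

record ('v, 'n) marked_tppav = "'v tppav" +
  tp_marking :: "real^'n::finite \<Rightarrow> 'v"

text \<open>The set of \<open>r *\<^sub>R v\<close> with \<open>r\<close> rational and \<open>v\<close> in the lattice is \<open>\<Lambda> \<otimes> \<rat>\<close>.\<close>

definition is_tppav :: "nat \<Rightarrow> ('v::real_vector, 'm) tppav_scheme \<Rightarrow> bool" where
  "is_tppav g X \<longleftrightarrow>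
     subspace (tp_space X) \<and> dim (tp_space X) = g \<and>
     lattice_in (tp_space X) (tp_lattice X) \<and>
     quadratic_form_on (tp_space X) (tp_form X) \<and>
     (\<forall>x\<in>tp_space X. 0 \<le> tp_form X x) \<and>
     (\<exists>B. B \<subseteq> {r *\<^sub>R v |r v. r \<in> \<rat> \<and> v \<in> tp_lattice X} \<and> independent B \<and>
          span B = null_space_on (tp_space X) (tp_form X))"

definition is_pure_tppav :: "nat \<Rightarrow> ('v::real_vector, 'm) tppav_scheme \<Rightarrow> bool" where
  "is_pure_tppav g X \<longleftrightarrow> is_tppav g X \<and> (\<forall>x\<in>tp_space X. x \<noteq> 0 \<longrightarrow> 0 < tp_form X x)"

definition is_marking :: "('v::real_vector, 'n::finite) marked_tppav \<Rightarrow> bool" where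
  "is_marking X \<longleftrightarrow>
     linear (tp_marking X) \<and> bij_betw (tp_marking X) UNIV (tp_space X) \<and>
     tp_marking X ` integral_vectors = tp_lattice X"

definition marked_tppavs :: "('v::real_vector, 'n::finite) marked_tppav set" where
  "marked_tppavs = {X. is_tppav CARD('n) X \<and> is_marking X}"

definition marked_pure_tppavs :: "('v::real_vector, 'n::finite) marked_tppav set" where
  "marked_pure_tppavs = {X. is_pure_tppav CARD('n) X \<and> is_marking X}"

definition marked_iso ::
    "('v::real_vector, 'n::finite) marked_tppav \<Rightarrow> ('w::real_vector, 'n) marked_tppav \<Rightarrow> bool" where
  "marked_iso X Y \<longleftrightarrow>
     (\<exists>h. linear h \<and> bij_betw h (tp_space X) (tp_space Y) \<and>
          h ` tp_lattice X = tp_lattice Y \<and>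
          (\<forall>x\<in>tp_space X. tp_form Y (h x) = tp_form X x) \<and>
          h \<circ> tp_marking X = tp_marking Y)"

definition iso_classes ::
    "('v::real_vector, 'n::finite) marked_tppav set \<Rightarrow> ('v, 'n) marked_tppav set set" where
  "iso_classes S = S // {(X, Y). X \<in> S \<and> Y \<in> S \<and> marked_iso X Y}"

text \<open>\<open>std_tppav A\<close> is \<open>(\<real>\<^sup>g/\<int>\<^sup>g, A, id)\<close>.\<close>

definition std_tppav :: "real^'n^'n \<Rightarrow> (real^'n, 'n) marked_tppav" where
  "std_tppav A =
     \<lparr>tp_space = UNIV, tp_lattice = integral_vectors, tp_form = (\<lambda>x. x \<bullet> (A *v x)),
      tp_marking = (\<lambda>x. x)\<rparr>"

text \<open>The marked objects (among those in \<open>S\<close>) to which a point \<open>p\<close> of a tropical Siegel space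
  corresponds. If \<open>p\<close> contained two different forms, this would be a union of several
  isomorphism classes.\<close>

definition point_class ::
    "('v::real_vector, 'n::finite) marked_tppav set \<Rightarrow> ((real^'n^'n) set \<times> (real^'n^'n)) set
      \<Rightarrow> ('v, 'n) marked_tppav set" where
  "point_class S p = {X \<in> S. \<exists>\<sigma> A. (\<sigma>, A) \<in> p \<and> marked_iso (std_tppav A) X}"

text \<open>\<open>\<phi>\<^sup>*(Q)\<close> as a symmetric matrix.\<close>

definition pullback_form :: "('v::real_vector, 'n::finite) marked_tppav \<Rightarrow> real^'n^'n" where
  "pullback_form X =
     (THE A. A \<in> symmetric_matrices \<and> (\<forall>x. x \<bullet> (A *v x) = tp_form X (tp_marking X x)))"

text \<open>The map \<open>(V/\<Lambda>, Q, \<phi>) \<mapsto> \<phi>\<^sup>*(Q)\<close>, evaluated on the marked objects with \<open>V\<close> inside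
  \<open>\<real>\<^sup>g\<close> corresponding to a point.\<close>

definition siegel_map :: "((real^'n^'n) set \<times> (real^'n^'n)) set \<Rightarrow> real^'n^'n" where
  "siegel_map p =
     (THE A. \<exists>X \<in> point_class (marked_tppavs :: (real^'n, 'n) marked_tppav set) p.
        A = pullback_form X)"

end

theory Submission
  imports Defs
begin

text \<open>The glueing identifies two points of the disjoint union exactly when they are the same form, so
  the glued space is the union of the cones carrying the coherent topology. That topology is the
  subspace topology on the positive definite forms because \<open>\<Sigma>\<close> is locally finite there.

  Local finiteness reduces to one cone \<open>\<sigma> = cone(S)\<close>. If \<open>M B M\<^sup>t\<close> lies near a positive definite
  form with \<open>B \<in> \<sigma>\<close> and \<open>M \<in> GL\<^sub>g(\<int>)\<close>, then \<open>B\<close> is bounded below by a fixed constant on nonzero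
  integral vectors. Rationality of the null spaces of the forms in \<open>\<sigma>\<close> upgrades this to \<open>B \<ge> d I\<close>
  with \<open>d\<close> independent of \<open>B\<close>; hence \<open>d M M\<^sup>t \<le> M B M\<^sup>t\<close> is bounded and only finitely many integral
  matrices \<open>M\<close> occur.\<close>

section \<open>Glueing along common faces\<close>

text \<open>A lower bound on nonzero integral vectors does not control a general form on real
  vectors: for g \<ge> 2 the forms M M^t with M in GL_g(\<int>) are all at least 1 there, yet take
  arbitrarily small values on real unit vectors. Inside one cone this is ruled out because the cone
  has finitely many generators and every degenerate form in it has an integral null vector, so d
  depends on the generators and on the bound only. Integral vectors are the right test set because
  M^t permutes them while it distorts lengths without control. At the semidefinite boundary the
  argument breaks down: every cone contains 0, so an infinite \<Sigma> is not locally finite there.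
  Hence the full space is only shown to map continuously and bijectively.\<close>

lemma symcl_rtrancl_snd_eq:
  assumes "(p, q) \<in> (R \<union> R\<inverse>)\<^sup>*" and "\<And>p q. (p, q) \<in> R \<Longrightarrow> snd p = snd q"
  shows "snd p = snd q"
  using assms(1) by induction (auto dest: assms(2))

text \<open>These are the properties shared by \<Sigma> and its restriction to the positive definite
  forms, so the glueing is analysed once for both. \<open>Int_mem\<close> asks for a common point
  because two members of the restriction may be disjoint, and the empty set is not a member.\<close>

locale facial_family =
  fixes C :: "'a::euclidean_space set set"
  assumes Int_mem: "\<lbrakk>\<sigma> \<in> C; \<tau> \<in> C; x \<in> \<sigma>; x \<in> \<tau>\<rbrakk> \<Longrightarrow> \<sigma> \<inter> \<tau> \<in> C"
    and Int_face: "\<lbrakk>\<sigma> \<in> C; \<tau> \<in> C\<rbrakk> \<Longrightarrow> \<sigma> \<inter> \<tau> face_of \<sigma>"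
    and ex_rel_interior: "x \<in> \<Union>C \<Longrightarrow> \<exists>\<tau>\<in>C. x \<in> rel_interior \<tau>"
begin

lemma Int_face': "\<lbrakk>\<sigma> \<in> C; \<tau> \<in> C\<rbrakk> \<Longrightarrow> \<sigma> \<inter> \<tau> face_of \<tau>"
  using Int_face[of \<tau> \<sigma>] by (simp add: Int_commute)

text \<open>Two cones through x are linked by two glueing steps, down to and up from their common
  face; conversely every glueing map is the identity, so no chain of steps changes the
  point.\<close>

lemma glue_rel_iff:
  "((\<sigma>, x), (\<tau>, y)) \<in> glue_rel C (\<lambda>\<sigma>. \<sigma>) (face_inclusions C) \<longleftrightarrow>
     \<sigma> \<in> C \<and> \<tau> \<in> C \<and> x \<in> \<sigma> \<and> x \<in> \<tau> \<and> x = y"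
proof -
  define R where "R = {((i, x), (j, f x)) |i j f x. (i, j, f) \<in> face_inclusions C \<and> x \<in> i}"
  have step: "((\<sigma>, x), (\<tau>, x)) \<in> R" if "\<sigma> \<in> C" "\<tau> \<in> C" "\<sigma> face_of \<tau>" "x \<in> \<sigma>" for \<sigma> \<tau> x
    unfolding R_def face_inclusions_def using that by fastforce
  have "((\<sigma>, x), (\<tau>, x)) \<in> (R \<union> R\<inverse>)\<^sup>*" if "\<sigma> \<in> C" "\<tau> \<in> C" "x \<in> \<sigma>" "x \<in> \<tau>" for \<sigma> \<tau> x
  proof -
    have "((\<sigma> \<inter> \<tau>, x), (\<sigma>, x)) \<in> R" "((\<sigma> \<inter> \<tau>, x), (\<tau>, x)) \<in> R"
      using that by (auto intro!: step Int_mem Int_face Int_face')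
    then show ?thesis
      by (meson UnI1 UnI2 converse.intros converse_rtrancl_into_rtrancl r_into_rtrancl)
  qed
  moreover have "snd p = snd q" if "(p, q) \<in> (R \<union> R\<inverse>)\<^sup>*" for p q
    by (rule symcl_rtrancl_snd_eq[OF that]) (auto simp: R_def face_inclusions_def)
  ultimately show ?thesis
    unfolding glue_rel_def R_def[symmetric] Let_def by fastforce
qed

text \<open>The glueing class of x, written without reference to a chosen cone. It is empty when no
  cone contains x, so injectivity can only hold on the union.\<close>

definition point :: "'a \<Rightarrow> ('a set \<times> 'a) set" where
  "point x = {(\<sigma>, x) |\<sigma>. \<sigma> \<in> C \<and> x \<in> \<sigma>}"

lemma glue_rel_class:
  "\<sigma> \<in> C \<Longrightarrow> x \<in> \<sigma> \<Longrightarrow> glue_rel C (\<lambda>\<sigma>. \<sigma>) (face_inclusions C) `` {(\<sigma>, x)} = point x"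
  by (auto simp: glue_rel_iff point_def)

lemma mem_point_iff: "(\<sigma>, y) \<in> point x \<longleftrightarrow> \<sigma> \<in> C \<and> x \<in> \<sigma> \<and> y = x"
  by (auto simp: point_def)

lemma inj_on_point: "inj_on point (\<Union>C)"
  by (rule inj_onI) (auto simp: point_def set_eq_iff)

lemma quotient_eq: "Sigma C (\<lambda>\<sigma>. \<sigma>) // glue_rel C (\<lambda>\<sigma>. \<sigma>) (face_inclusions C) = point ` \<Union>C"
proof -
  have "Sigma C (\<lambda>\<sigma>. \<sigma>) // glue_rel C (\<lambda>\<sigma>. \<sigma>) (face_inclusions C) =
      (\<lambda>p. point (snd p)) ` Sigma C (\<lambda>\<sigma>. \<sigma>)"
  proof -
    have "Sigma C (\<lambda>\<sigma>. \<sigma>) // glue_rel C (\<lambda>\<sigma>. \<sigma>) (face_inclusions C) =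
        (\<lambda>p. glue_rel C (\<lambda>\<sigma>. \<sigma>) (face_inclusions C) `` {p}) ` Sigma C (\<lambda>\<sigma>. \<sigma>)"
      unfolding quotient_def by (rule UNION_singleton_eq_range)
    also have "\<dots> = (\<lambda>p. point (snd p)) ` Sigma C (\<lambda>\<sigma>. \<sigma>)"
      by (rule image_cong[OF refl]) (auto simp: glue_rel_iff point_def)
    finally show ?thesis .
  qed
  also have "\<dots> = point ` snd ` Sigma C (\<lambda>\<sigma>. \<sigma>)"
    by (simp add: image_image)
  also have "snd ` Sigma C (\<lambda>\<sigma>. \<sigma>) = \<Union>C"
    by (auto simp: image_iff Bex_def)
  finally show ?thesis .
qed

lemma openin_glued_iff:
  "openin (glued_space C (\<lambda>\<sigma>. \<sigma>) (face_inclusions C)) U \<longleftrightarrow>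
     U \<subseteq> point ` \<Union>C \<and> (\<forall>\<sigma>\<in>C. openin (top_of_set \<sigma>) {x \<in> \<sigma>. point x \<in> U})"
proof -
  have *: "{x. (\<sigma>, x) \<in> {z \<in> Sigma C (\<lambda>\<sigma>. \<sigma>).
        glue_rel C (\<lambda>\<sigma>. \<sigma>) (face_inclusions C) `` {z} \<in> U}} = {x \<in> \<sigma>. point x \<in> U}"
    if "\<sigma> \<in> C" for \<sigma>
    using that by (auto simp: glue_rel_class)
  have "topspace \<circ> top_of_set = (\<lambda>\<sigma>::'a set. \<sigma>)"
    by auto
  then have sig: "topspace (sum_topology top_of_set C) = Sigma C (\<lambda>\<sigma>. \<sigma>)"
    by simp
  show ?thesis
    unfolding glued_space_def openin_quotient_topology openin_sum_topology sig quotient_eq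
    using * by auto
qed

lemma topspace_glued: "topspace (glued_space C (\<lambda>\<sigma>. \<sigma>) (face_inclusions C)) = point ` \<Union>C"
proof -
  have "openin (glued_space C (\<lambda>\<sigma>. \<sigma>) (face_inclusions C)) (point ` \<Union>C)"
    unfolding openin_glued_iff
  proof (intro conjI ballI)
    fix \<sigma> assume "\<sigma> \<in> C"
    then have "{x \<in> \<sigma>. point x \<in> point ` \<Union>C} = \<sigma>" by blast
    then show "openin (top_of_set \<sigma>) {x \<in> \<sigma>. point x \<in> point ` \<Union>C}"
      by simp
  qed simp
  then show ?thesis
    by (intro subset_antisym openin_subset openin_glued_iff[THEN iffD1, OF openin_topspace, THEN conjunct1])
qed

text \<open>An ambient open set has an open trace on every cone, so the coherent topology is at
  least as fine as the subspace topology. Asking only that \<open>f\<close> inverts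
  \<open>point\<close> allows both \<open>siegel_map\<close> and its composite with
  \<open>pure_inclusion\<close>.\<close>

lemma continuous_map_glued:
  assumes "\<And>x. x \<in> \<Union>C \<Longrightarrow> f (point x) = x"
  shows "continuous_map (glued_space C (\<lambda>\<sigma>. \<sigma>) (face_inclusions C)) (top_of_set (\<Union>C)) f"
  unfolding continuous_map_alt topspace_glued
proof (intro conjI allI impI)
  show "f \<in> point ` \<Union>C \<rightarrow> topspace (top_of_set (\<Union>C))"
  proof
    fix p assume "p \<in> point ` \<Union>C"
    then obtain x where "x \<in> \<Union>C" "p = point x" by blast
    then show "f p \<in> topspace (top_of_set (\<Union>C))"
      using assms[of x] by simp
  qed
  fix V assume "openin (top_of_set (\<Union>C)) V"
  then obtain W where W: "open W" "V = \<Union>C \<inter> W"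
    by (auto simp: openin_open)
  have "{x \<in> \<sigma>. point x \<in> f -` V \<inter> point ` \<Union>C} = \<sigma> \<inter> W" if "\<sigma> \<in> C" for \<sigma>
  proof -
    have "point x \<in> f -` V \<inter> point ` \<Union>C \<longleftrightarrow> x \<in> W" if "x \<in> \<sigma>" for x
    proof -
      have x: "x \<in> \<Union>C"
        using that \<open>\<sigma> \<in> C\<close> by blast
      then show ?thesis
        unfolding Int_iff vimage_eq assms[OF x] W(2) by blast
    qed
    then show ?thesis by blast
  qed
  then show "openin (glued_space C (\<lambda>\<sigma>. \<sigma>) (face_inclusions C)) (f -` V \<inter> point ` \<Union>C)"
    unfolding openin_glued_iff using W by (auto simp: openin_open)
qed

lemma bij_betw_glued:
  assumes "\<And>x. x \<in> \<Union>C \<Longrightarrow> f (point x) = x"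
  shows "bij_betw f (topspace (glued_space C (\<lambda>\<sigma>. \<sigma>) (face_inclusions C))) (\<Union>C)"
proof -
  have "f ` (point ` \<Union>C) = \<Union>C"
    unfolding image_image using assms image_cong[of "\<Union>C" "\<Union>C" "\<lambda>x. f (point x)" "\<lambda>x. x"] by simp
  moreover have "inj_on f (point ` \<Union>C)"
  proof (rule inj_onI)
    fix p q assume "p \<in> point ` \<Union>C" "q \<in> point ` \<Union>C" and eq: "f p = f q"
    then obtain x y where "x \<in> \<Union>C" "p = point x" "y \<in> \<Union>C" "q = point y" by blast
    then show "p = q"
      using assms[of x] assms[of y] eq by simp
  qed
  ultimately show ?thesis
    unfolding topspace_glued by (simp add: bij_betw_def)
qed

text \<open>The converse comparison of topologies: a set whose trace on each closed cone is closed
  is a locally finite union of closed sets, hence closed.\<close>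

lemma homeomorphic_map_glued:
  assumes f: "\<And>x. x \<in> \<Union>C \<Longrightarrow> f (point x) = x"
    and clo: "\<And>\<sigma>. \<sigma> \<in> C \<Longrightarrow> closedin (top_of_set (\<Union>C)) \<sigma>"
    and fin: "\<And>x. x \<in> \<Union>C \<Longrightarrow> \<exists>W. open W \<and> x \<in> W \<and> finite {\<sigma> \<in> C. \<sigma> \<inter> W \<noteq> {}}"
  shows "homeomorphic_map (glued_space C (\<lambda>\<sigma>. \<sigma>) (face_inclusions C)) (top_of_set (\<Union>C)) f"
proof (rule bijective_open_imp_homeomorphic_map)
  show "open_map (glued_space C (\<lambda>\<sigma>. \<sigma>) (face_inclusions C)) (top_of_set (\<Union>C)) f"
    unfolding open_map_def
  proof (intro allI impI)
    fix U assume "openin (glued_space C (\<lambda>\<sigma>. \<sigma>) (face_inclusions C)) U"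
    then have sub: "U \<subseteq> point ` \<Union>C"
      and op: "\<And>\<sigma>. \<sigma> \<in> C \<Longrightarrow> openin (top_of_set \<sigma>) {x \<in> \<sigma>. point x \<in> U}"
      by (auto simp: openin_glued_iff)
    \<comment> \<open>The part of each cone outside \<open>U\<close>. Complements are used because
      the cones are closed in the union, so relatively closed pieces of a cone stay closed, whereas
      relatively open ones need not stay open.\<close>
    let ?Z = "\<lambda>\<sigma>. \<sigma> - {x \<in> \<sigma>. point x \<in> U}"
    have closed_Z: "closedin (top_of_set (\<Union>C)) (\<Union>(?Z ` C))"
    proof (rule closedin_locally_finite_Union)
      fix S assume "S \<in> ?Z ` C"
      then obtain \<sigma> where \<sigma>: "\<sigma> \<in> C" "S = ?Z \<sigma>" by blast
      then have "closedin (top_of_set \<sigma>) S"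
        using closedin_diff[OF closedin_topspace op[of \<sigma>]] by simp
      then show "closedin (top_of_set (\<Union>C)) S"
        using clo \<sigma>(1) closedin_trans by blast
    next
      have "locally_finite_in (top_of_set (\<Union>C)) C"
        unfolding locally_finite_in_def
      proof (intro conjI ballI)
        fix x assume "x \<in> topspace (top_of_set (\<Union>C))"
        then have x: "x \<in> \<Union>C" by simp
        then obtain W where W: "open W" "x \<in> W" "finite {\<sigma> \<in> C. \<sigma> \<inter> W \<noteq> {}}"
          using fin by blast
        have "finite {\<sigma> \<in> C. \<sigma> \<inter> (\<Union>C \<inter> W) \<noteq> {}}"
          by (rule finite_subset[OF _ W(3)]) auto
        then show "\<exists>V. openin (top_of_set (\<Union>C)) V \<and> x \<in> V \<and> finite {U \<in> C. U \<inter> V \<noteq> {}}"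
          using W x by (intro exI[of _ "\<Union>C \<inter> W"]) (auto intro: openin_open_Int)
      qed simp
      then show "locally_finite_in (top_of_set (\<Union>C)) (?Z ` C)"
        by (rule locally_finite_in_refinement) blast
    qed
    have "f ` U = \<Union>C - \<Union>(?Z ` C)"
    proof -
      have "x \<in> f ` U \<longleftrightarrow> x \<in> \<Union>C \<and> point x \<in> U" for x
      proof
        assume "x \<in> f ` U"
        then obtain y where y: "y \<in> \<Union>C" "point y \<in> U" "x = f (point y)"
          using sub by blast
        then show "x \<in> \<Union>C \<and> point x \<in> U"
          using f[OF y(1)] by simp
      next
        assume "x \<in> \<Union>C \<and> point x \<in> U"
        then show "x \<in> f ` U"
          using f[of x] by (intro image_eqI[of _ _ "point x"]) auto
      qed
      then show ?thesis by blast
    qed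
    then show "openin (top_of_set (\<Union>C)) (f ` U)"
      using openin_diff[OF openin_topspace closed_Z] by simp
  qed
  show "f ` topspace (glued_space C (\<lambda>\<sigma>. \<sigma>) (face_inclusions C)) = topspace (top_of_set (\<Union>C))"
    "inj_on f (topspace (glued_space C (\<lambda>\<sigma>. \<sigma>) (face_inclusions C)))"
    using bij_betw_glued[OF f] by (simp_all add: bij_betw_def)
qed (rule continuous_map_glued[OF f])

text \<open>A face that meets the relative interior of a convex set is the whole set; this applies
  to the common face from both sides.\<close>

lemma rel_interior_unique:
  assumes "\<sigma> \<in> C" "\<tau> \<in> C" "x \<in> rel_interior \<sigma>" "x \<in> rel_interior \<tau>"
  shows "\<sigma> = \<tau>"
proof -
  have "x \<in> \<sigma> \<inter> \<tau>"
    using assms(3,4) rel_interior_subset by blast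
  then have "\<sigma> \<subseteq> \<sigma> \<inter> \<tau>" "\<tau> \<subseteq> \<sigma> \<inter> \<tau>"
    using subset_of_face_of[OF Int_face[OF assms(1,2)], of \<sigma>]
      subset_of_face_of[OF Int_face'[OF assms(1,2)], of \<tau>] assms(3,4) by blast+
  then show ?thesis by blast
qed

text \<open>No two distinct points of one cone are glued, so each stratum consists of singleton
  classes and the claim becomes that every point lies in the relative interior of exactly one
  cone.\<close>

lemma bij_betw_strata:
  "bij_betw (\<lambda>(i, c). glue_rel C (\<lambda>\<sigma>. \<sigma>) (face_inclusions C) `` ({i} \<times> c))
     (SIGMA i:C. rel_interior i //
        {(x, y). x \<in> rel_interior i \<and> y \<in> rel_interior i \<and>
                 ((i, x), (i, y)) \<in> glue_rel C (\<lambda>\<sigma>. \<sigma>) (face_inclusions C)})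
     (topspace (glued_space C (\<lambda>\<sigma>. \<sigma>) (face_inclusions C)))"
    (is "bij_betw ?g ?D _")
proof -
  have "rel_interior i //
        {(x, y). x \<in> rel_interior i \<and> y \<in> rel_interior i \<and>
                 ((i, x), (i, y)) \<in> glue_rel C (\<lambda>\<sigma>. \<sigma>) (face_inclusions C)} =
      (\<lambda>x. {x}) ` rel_interior i" (is "_ // ?r = _") if "i \<in> C" for i
  proof -
    have "?r `` {x} = {x}" if "x \<in> rel_interior i" for x
      using that \<open>i \<in> C\<close> rel_interior_subset[of i] by (auto simp: glue_rel_iff)
    then show ?thesis
      unfolding quotient_def by auto
  qed
  then have D: "?D = (SIGMA i:C. (\<lambda>x. {x}) ` rel_interior i)"
    by (rule Sigma_cong[OF refl])
  have g: "?g (i, {x}) = point x" if "i \<in> C" "x \<in> rel_interior i" for i x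
    using that glue_rel_class[of i x] rel_interior_subset[of i] by auto
  have in_U: "x \<in> \<Union>C" if "i \<in> C" "x \<in> rel_interior i" for i x
    using that rel_interior_subset[of i] by auto
  show ?thesis
    unfolding D topspace_glued bij_betw_def
  proof (intro conjI)
    show "inj_on ?g (SIGMA i:C. (\<lambda>x. {x}) ` rel_interior i)"
    proof (rule inj_onI)
      fix p q
      assume "p \<in> (SIGMA i:C. (\<lambda>x. {x}) ` rel_interior i)"
        "q \<in> (SIGMA i:C. (\<lambda>x. {x}) ` rel_interior i)" and eq: "?g p = ?g q"
      then obtain i x j y where p: "p = (i, {x})" "i \<in> C" "x \<in> rel_interior i"
        and q: "q = (j, {y})" "j \<in> C" "y \<in> rel_interior j" by blast
      have "point x = point y"
        using eq g[OF p(2,3)] g[OF q(2,3)] unfolding p(1) q(1) by simp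
      then have "x = y"
        using in_U p q inj_on_point by (auto dest: inj_onD)
      then show "p = q"
        using p q rel_interior_unique by blast
    qed
    show "?g ` (SIGMA i:C. (\<lambda>x. {x}) ` rel_interior i) = point ` \<Union>C"
    proof (intro equalityI subsetI)
      fix z assume "z \<in> ?g ` (SIGMA i:C. (\<lambda>x. {x}) ` rel_interior i)"
      then obtain i x where "i \<in> C" "x \<in> rel_interior i" "z = ?g (i, {x})" by blast
      then show "z \<in> point ` \<Union>C"
        using g[of i x] in_U[of i x] by auto
    next
      fix z assume "z \<in> point ` \<Union>C"
      then obtain x where "x \<in> \<Union>C" "z = point x" by blast
      moreover from this obtain \<tau> where "\<tau> \<in> C" "x \<in> rel_interior \<tau>"
        using ex_rel_interior by blast
      ultimately show "z \<in> ?g ` (SIGMA i:C. (\<lambda>x. {x}) ` rel_interior i)"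
        using g by (intro image_eqI[of _ _ "(\<tau>, {x})"]) auto
    qed
  qed
qed

lemma ideal_stacky_fanI:
  assumes "\<And>\<sigma>. \<sigma> \<in> C \<Longrightarrow> ideal_cone L \<sigma>"
  shows "ideal_stacky_fan L C (\<lambda>\<sigma>. \<sigma>) (face_inclusions C)"
  unfolding ideal_stacky_fan_def
proof (intro conjI bij_betw_strata)
  show "\<forall>(i, j, f)\<in>face_inclusions C.
      i \<in> C \<and> j \<in> C \<and> lattice_preserving_on L i f \<and> f ` i face_of j"
    by (auto simp: face_inclusions_def lattice_preserving_on_def linear_id[unfolded id_def])
qed (use assms in blast)

end

section \<open>Relative interiors of faces and of open slices\<close>

text \<open>A face of least dimension through x works: outside its relative interior, x would lie on
  a facet of it, which is again a face of the polyhedron.\<close>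

lemma polyhedron_rel_interior_face:
  fixes S :: "'a::euclidean_space set"
  assumes "polyhedron S" "x \<in> S"
  obtains F where "F face_of S" "x \<in> rel_interior F"
proof -
  \<comment> \<open>The shift turns the affine dimension, which is -1 on the empty set, into a
    natural number, so that a least value exists.\<close>
  define m where "m F = nat (aff_dim F + 1)" for F :: "'a set"
  obtain F where F: "F face_of S \<and> x \<in> F"
    and min: "\<And>G. G face_of S \<and> x \<in> G \<Longrightarrow> m F \<le> m G"
    using assms face_of_refl[OF polyhedron_imp_convex]
      ex_has_least_nat[of "\<lambda>F. F face_of S \<and> x \<in> F" S m] by blast
  have poly: "polyhedron F"
    using assms F face_of_polyhedron_polyhedron by blast
  have "x \<in> rel_interior F"
  proof (rule ccontr)
    assume "x \<notin> rel_interior F"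
    then obtain G where G: "G facet_of F" "x \<in> G"
      using F rel_interior_of_polyhedron[OF poly] by blast
    then have "G face_of S"
      using F face_of_trans facet_of_imp_face_of by blast
    then have "m F \<le> m G"
      using min G by blast
    moreover have "aff_dim G = aff_dim F - 1" "aff_dim G \<ge> 0"
      using G aff_dim_negative_iff[of G] by (auto simp: facet_of_def not_less[symmetric])
    ultimately show False
      by (simp add: m_def)
  qed
  with F that show thesis by blast
qed

text \<open>Intersecting can only shrink the affine hull, so a smaller ball still fits. This carries
  the strata of \<Sigma> over to the positive definite parts.\<close>

lemma rel_interior_Int_open_mem:
  fixes S :: "'a::euclidean_space set"
  assumes "x \<in> rel_interior S" "open U" "x \<in> U"
  shows "x \<in> rel_interior (S \<inter> U)"
proof -
  obtain e where e: "x \<in> S" "e > 0" "ball x e \<inter> affine hull S \<subseteq> S"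
    using assms(1) mem_rel_interior_ball by blast
  obtain e' where e': "e' > 0" "ball x e' \<subseteq> U"
    using assms(2,3) open_contains_ball by blast
  have "ball x (min e e') \<inter> affine hull (S \<inter> U) \<subseteq> S \<inter> U"
    using e(3) e'(2) hull_mono[of "S \<inter> U" S affine] by auto
  then show ?thesis
    unfolding mem_rel_interior_ball using e e' assms(3) by (intro conjI exI[of _ "min e e'"]) auto
qed

section \<open>Positive semidefinite forms and local finiteness\<close>

abbreviation quad :: "real^'n^'n \<Rightarrow> real^'n \<Rightarrow> real" where
  "quad A x \<equiv> x \<bullet> (A *v x)"

text \<open>The rank-one matrix x x^t. Through it, evaluation at x becomes a linear functional of
  the form, which makes Cauchy-Schwarz and supporting hyperplanes available.\<close>

definition square_matrix :: "real^'n \<Rightarrow> real^'n^'n" where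
  "square_matrix x = (\<chi> i j. x $ i * x $ j)"

lemma quad_eq_inner: "quad A x = square_matrix x \<bullet> A"
  by (simp add: inner_vec_def square_matrix_def matrix_vector_mult_def sum_distrib_left mult_ac)

lemma norm_square_matrix: "norm (square_matrix x) = x \<bullet> x"
proof -
  have "square_matrix x \<bullet> square_matrix x = (x \<bullet> x) * (x \<bullet> x)"
    by (simp add: inner_vec_def square_matrix_def sum_distrib_left sum_distrib_right mult_ac)
  then show ?thesis
    by (simp add: norm_eq_sqrt_inner)
qed

lemma abs_quad_le: "\<bar>quad A x\<bar> \<le> norm A * (x \<bullet> x)"
  unfolding quad_eq_inner using Cauchy_Schwarz_ineq2[of "square_matrix x" A]
  by (simp add: norm_square_matrix mult.commute)

lemma quad_scaleR: "quad A (r *\<^sub>R x) = r\<^sup>2 * quad A x"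
  by (simp add: matrix_vector_mult_scaleR power2_eq_square)

lemma quad_conj: "quad (M ** A ** transpose M) x = quad A (transpose M *v x)"
  by (metis dot_lmul_matrix matrix_vector_mul_assoc transpose_matrix_vector)

text \<open>The constant is the minimum over the compact unit sphere; homogeneity of degree 2
  extends it to all vectors.\<close>

lemma pos_def_lower_bound:
  fixes A :: "real^'n^'n"
  assumes "\<And>x. x \<noteq> 0 \<Longrightarrow> 0 < quad A x"
  obtains c where "c > 0" "\<And>x. c * (x \<bullet> x) \<le> quad A x"
proof -
  let ?S = "sphere (0::real^'n) 1"
  have ne: "?S \<noteq> {}"
    by (metis norm_axis_1 ex_in_conv mem_sphere_0)
  have "continuous_on ?S (quad A)"
    by (intro continuous_intros matrix_vector_mult_linear_continuous_on)
  then obtain y where y: "y \<in> ?S" "\<And>x. x \<in> ?S \<Longrightarrow> quad A y \<le> quad A x"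
    using continuous_attains_inf[OF compact_sphere ne] by blast
  show thesis
  proof (rule that[of "quad A y"])
    show "0 < quad A y"
      using assms[of y] y(1) by force
    fix x :: "real^'n"
    show "quad A y * (x \<bullet> x) \<le> quad A x"
    proof (cases "x = 0")
      case False
      have "quad A x = (norm x)\<^sup>2 * quad A (x /\<^sub>R norm x)"
        using False unfolding quad_scaleR by (simp add: power_inverse)
      moreover have "quad A y \<le> quad A (x /\<^sub>R norm x)"
        using False by (intro y(2)) simp
      ultimately have "(norm x)\<^sup>2 * quad A y \<le> quad A x"
        by (metis mult_left_mono zero_le_power2)
      then show ?thesis
        by (simp only: power2_norm_eq_inner mult.commute)
    qed simp
  qed
qed

text \<open>Symmetry is omitted from the set so that it is open among all matrices; for g \<ge> 2
  the symmetric ones form a proper subspace. The radius is the coercivity constant, since a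
  perturbation of smaller norm cannot cancel it.\<close>

lemma open_pos_def: "open {A :: real^'n^'n. \<forall>x. x \<noteq> 0 \<longrightarrow> 0 < quad A x}" (is "open ?U")
  unfolding open_contains_ball
proof
  fix A :: "real^'n^'n" assume "A \<in> ?U"
  then obtain c where c: "c > 0" "\<And>x. c * (x \<bullet> x) \<le> quad A x"
    using pos_def_lower_bound[of A] by blast
  have "B \<in> ?U" if "B \<in> ball A c" for B
  proof (intro CollectI allI impI)
    fix x :: "real^'n" assume "x \<noteq> 0"
    then have "norm (A - B) * (x \<bullet> x) < c * (x \<bullet> x)"
      using that by (simp add: dist_norm)
    moreover have "quad A x - quad B x \<le> norm (A - B) * (x \<bullet> x)"
      using abs_quad_le[of x "A - B"] by (simp add: matrix_vector_mult_diff_rdistrib inner_diff_right)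
    ultimately show "0 < quad B x"
      using c(2)[of x] by linarith
  qed
  then show "\<exists>e>0. ball A e \<subseteq> ?U"
    using c(1) by blast
qed

lemma symmetric_inner_commute:
  "A \<in> symmetric_matrices \<Longrightarrow> x \<bullet> (A *v y) = y \<bullet> (A *v x)"
  using dot_lmul_matrix[of x A y] transpose_matrix_vector[of A x]
  by (simp add: symmetric_matrices_def inner_commute)

lemma polar_form:
  "A \<in> symmetric_matrices \<Longrightarrow> quad A (x + y) - quad A x - quad A y = 2 * (y \<bullet> (A *v x))"
  using symmetric_inner_commute[of A x y]
  by (simp add: matrix_vector_right_distrib inner_add_left inner_add_right)

text \<open>If A x were a nonzero vector y, a small move from x in direction -y would have a
  negative first-order term that beats the second-order one, against semidefiniteness.\<close>

lemma quad_eq_0_iff: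
  assumes "A \<in> symmetric_matrices" "\<And>x. 0 \<le> quad A x"
  shows "quad A x = 0 \<longleftrightarrow> A *v x = 0"
proof
  assume x: "quad A x = 0"
  show "A *v x = 0"
  proof (rule ccontr)
    define y where "y = A *v x"
    assume "A *v x \<noteq> 0"
    then have y: "0 < y \<bullet> y"
      by (simp add: y_def)
    \<comment> \<open>Small enough that the quadratic term stays below half of the linear one; the
      summand 1 keeps the denominator positive when \<open>quad A y\<close> is 0.\<close>
    define s where "s = (y \<bullet> y) / (1 + quad A y)"
    have A: "0 \<le> quad A y" by (rule assms(2))
    have s: "s > 0" "s * quad A y \<le> y \<bullet> y"
      using y A by (simp_all add: s_def field_simps)
    have "quad A (x + (- s) *\<^sub>R y) = quad A x + s\<^sup>2 * quad A y - 2 * s * (y \<bullet> y)"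
      using polar_form[OF assms(1), of x "(- s) *\<^sub>R y"] quad_scaleR[of "- s" y A]
      by (simp add: y_def)
    also have "\<dots> = s * (s * quad A y - 2 * (y \<bullet> y))"
      using x by (simp add: power2_eq_square algebra_simps)
    also have "\<dots> < 0"
      by (rule mult_pos_neg) (use s y in linarith)+
    finally show False
      using assms(2)[of "x + (- s) *\<^sub>R y"] by linarith
  qed
qed simp

lemma pos_def_subset: "pos_def_cone \<subseteq> (rational_closure_cone :: (real^'n^'n) set)"
proof
  fix A :: "real^'n^'n" assume A: "A \<in> pos_def_cone"
  then have nonneg: "0 \<le> quad A x" for x
    by (cases "x = 0") (auto simp: pos_def_cone_def less_imp_le)
  have "{x. A *v x = 0} = {0}"
    using A by (force simp: pos_def_cone_def)
  then have "{} \<subseteq> rational_vectors \<and> independent {} \<and> span {} = {x. A *v x = 0}"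
    by (simp add: independent_empty)
  with A nonneg show "A \<in> rational_closure_cone"
    unfolding rational_closure_cone_def pos_def_cone_def by blast
qed

section \<open>Rational and integral vectors\<close>

lemma clear_denominators:
  assumes "finite I" "\<And>i. i \<in> I \<Longrightarrow> f i \<in> \<rat>"
  obtains d :: nat where "d > 0" "\<And>i. i \<in> I \<Longrightarrow> real d * f i \<in> \<int>"
  using assms
proof (induction I arbitrary: thesis)
  case empty
  then show ?case by (metis empty_iff zero_less_one)
next
  case (insert i I)
  then obtain d where d: "d > 0" "\<And>j. j \<in> I \<Longrightarrow> real d * f j \<in> \<int>"
    by (metis insertI2)
  obtain m n where mn: "n \<noteq> 0" "\<bar>f i\<bar> = real m / real n"
    using insert.prems(2)[of i] by (auto elim: Rats_abs_nat_div_natE)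
  show ?case
  proof (rule insert.prems(1)[of "d * n"])
    show "d * n > 0" using d mn by simp
    have "real n * f i \<in> {real m, - real m}"
      using mn by (auto simp: field_simps abs_if split: if_splits)
    then have ni: "real n * f i \<in> \<int>" by auto
    fix j assume j: "j \<in> insert i I"
    show "real (d * n) * f j \<in> \<int>"
    proof (cases "j = i")
      case True
      have "real (d * n) * f j = real d * (real n * f i)"
        using True by simp
      then show ?thesis
        using ni by (metis Ints_mult Ints_of_nat)
    next
      case False
      have "real (d * n) * f j = real n * (real d * f j)"
        by simp
      then show ?thesis
        using d(2)[of j] False j by (metis Ints_mult Ints_of_nat insertE)
    qed
  qed
qed

lemma rational_vector_multiple:
  assumes "x \<in> rational_vectors"
  obtains d :: nat where "d > 0" "real d *\<^sub>R x \<in> integral_vectors"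
  using clear_denominators[of UNIV "\<lambda>i. x $ i"] assms
  by (auto simp: rational_vectors_def integral_vectors_def)

lemma integral_norm_ge_1:
  assumes "x \<in> integral_vectors" "x \<noteq> 0"
  shows "1 \<le> x \<bullet> x"
proof -
  obtain i where "x $ i \<noteq> 0"
    using assms(2) by (auto simp: vec_eq_iff)
  moreover have "x $ i \<in> \<int>"
    using assms(1) by (simp add: integral_vectors_def)
  ultimately have "1 \<le> \<bar>x $ i\<bar>"
    by (rule Ints_nonzero_abs_ge1[rotated])
  also have "\<dots> \<le> norm x"
    by (rule component_le_norm_cart)
  finally have "1 * 1 \<le> norm x * norm x"
    by (intro mult_mono) auto
  then show ?thesis
    by (simp add: dot_square_norm power2_eq_square)
qed

lemma integral_matrix_vector:
  "M \<in> integral_matrices \<Longrightarrow> x \<in> integral_vectors \<Longrightarrow> M *v x \<in> integral_vectors"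
  by (auto simp: integral_matrices_def integral_vectors_def matrix_vector_mult_def
      intro!: Ints_sum Ints_mult)

lemma integral_transpose:
  "M \<in> integral_matrices \<Longrightarrow> transpose M \<in> integral_matrices"
  by (simp add: integral_matrices_def transpose_def)

section \<open>Finitely generated cones of semidefinite forms\<close>

lemma convex_cone_hull_finite_rep:
  assumes "finite S" "B \<in> convex_cone hull S"
  obtains l where "\<And>s. s \<in> S \<Longrightarrow> 0 \<le> l s" "B = (\<Sum>s\<in>S. l s *\<^sub>R s)"
proof -
  let ?K = "{B. \<exists>l. (\<forall>s\<in>S. 0 \<le> l s) \<and> B = (\<Sum>s\<in>S. l s *\<^sub>R s)}"
  have "convex_cone hull S \<subseteq> ?K"
  proof (rule hull_minimal)
    show "S \<subseteq> ?K"
    proof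
      fix s assume "s \<in> S"
      then have "(\<Sum>t\<in>S. (if t = s then 1 else 0) *\<^sub>R t) = s"
        using assms(1) by (simp add: if_distrib[of "\<lambda>c. c *\<^sub>R _"] cong: if_cong)
      then show "s \<in> ?K"
        by (intro CollectI exI[of _ "\<lambda>t. if t = s then 1 else 0"]) simp
    qed
    show "convex_cone ?K"
      unfolding convex_cone_iff
    proof (intro conjI ballI allI impI)
      show "0 \<in> ?K"
        by (intro CollectI exI[of _ "\<lambda>_. 0"]) simp
      fix x assume "x \<in> ?K"
      then obtain l where l: "\<forall>s\<in>S. 0 \<le> l s" "x = (\<Sum>s\<in>S. l s *\<^sub>R s)" by blast
      show "c *\<^sub>R x \<in> ?K" if "0 \<le> c" for c
        using that l by (intro CollectI exI[of _ "\<lambda>s. c * l s"]) (simp add: scaleR_sum_right)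
      fix y assume "y \<in> ?K"
      then obtain m where m: "\<forall>s\<in>S. 0 \<le> m s" "y = (\<Sum>s\<in>S. m s *\<^sub>R s)" by blast
      show "x + y \<in> ?K"
        using l m by (intro CollectI exI[of _ "\<lambda>s. l s + m s"]) (simp add: scaleR_left_distrib sum.distrib)
    qed
  qed
  with assms(2) that show thesis by blast
qed

lemma quad_sum: "quad (\<Sum>s\<in>T. l s *\<^sub>R s) x = (\<Sum>s\<in>T. l s * quad s x)"
  unfolding quad_eq_inner by (simp add: inner_sum_right)

lemma sum_mem_convex_cone_hull:
  assumes "finite T" "T \<subseteq> S"
  shows "\<Sum>T \<in> convex_cone hull S"
  using assms
proof (induction T)
  case empty
  then show ?case by (simp add: convex_cone_hull_contains_0)
next
  case (insert s T)
  then show ?case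
    by (simp add: convex_cone_hull_add hull_inc)
qed

text \<open>The only use of rational null spaces in the finiteness argument: a semidefinite form
  that is not definite has a nonzero kernel, and a rational basis vector of it can be scaled into
  the lattice.\<close>

lemma integral_kernel_vector:
  assumes "A \<in> rational_closure_cone" "A \<notin> pos_def_cone"
  obtains x where "x \<in> integral_vectors" "x \<noteq> 0" "A *v x = 0"
proof -
  have sym: "A \<in> symmetric_matrices" and nonneg: "\<And>x. 0 \<le> quad A x"
    using assms(1) by (auto simp: rational_closure_cone_def)
  obtain B where B: "B \<subseteq> rational_vectors" "independent B" "span B = {x. A *v x = 0}"
    using assms(1) by (auto simp: rational_closure_cone_def)
  have "\<exists>z. z \<noteq> 0 \<and> quad A z \<le> 0"
    using assms(2) sym by (auto simp: pos_def_cone_def not_less)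
  then obtain z where z: "z \<noteq> 0" "quad A z = 0"
    using nonneg by (meson order_antisym)
  then have "z \<in> span B"
    using B(3) quad_eq_0_iff[OF sym nonneg] by auto
  then have "B \<noteq> {}"
    using z(1) by auto
  then obtain b where b: "b \<in> B" by blast
  obtain d where d: "d > 0" "real d *\<^sub>R b \<in> integral_vectors"
    using rational_vector_multiple b B(1) by blast
  have "b \<noteq> 0"
    using b B(2) dependent_zero by blast
  moreover have "A *v b = 0"
    using b B(3) span_base by blast
  ultimately show thesis
    using d by (intro that[of "real d *\<^sub>R b"]) (auto simp: matrix_vector_mult_scaleR)
qed

text \<open>Uniformity in \<open>B\<close>: the generators carrying a coefficient above a fixed threshold already have a
  positive definite sum, since otherwise a common integral null vector would make \<open>B\<close> too small there.\<close>

lemma cone_lower_bound: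
  fixes S :: "(real^'n^'n) set"
  assumes "finite S" "convex_cone hull S \<subseteq> rational_closure_cone" "c > 0"
  obtains d where "d > 0"
    "\<And>B x. \<lbrakk>B \<in> convex_cone hull S; \<And>z. \<lbrakk>z \<in> integral_vectors; z \<noteq> 0\<rbrakk> \<Longrightarrow> c \<le> quad B z\<rbrakk> \<Longrightarrow>
       d * (x \<bullet> x) \<le> quad B x"
proof -
  \<comment> \<open>A finite set of generators has finitely many subsets, so constants taken over
    all of them are independent of the form \<open>B\<close> considered later.\<close>
  define bad where "bad = {T. T \<subseteq> S \<and> \<Sum>T \<notin> pos_def_cone}"
  define good where "good = {T. T \<subseteq> S \<and> \<Sum>T \<in> pos_def_cone}"
  have fin: "finite T" if "T \<subseteq> S" for T
    using assms(1) that finite_subset by blast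
  have closure: "\<Sum>T \<in> rational_closure_cone" if "T \<subseteq> S" for T
    using sum_mem_convex_cone_hull[OF fin[OF that] that] assms(2) by blast
  have nonneg: "0 \<le> quad s x" if "s \<in> S" for s x
    using that assms(2) hull_inc[of s S convex_cone] by (auto simp: rational_closure_cone_def)
  have "\<exists>x. x \<in> integral_vectors \<and> x \<noteq> 0 \<and> \<Sum>T *v x = 0" if "T \<in> bad" for T
    using that closure integral_kernel_vector unfolding bad_def by (metis (lifting) mem_Collect_eq)
  then obtain v where v: "\<And>T. T \<in> bad \<Longrightarrow> v T \<in> integral_vectors \<and> v T \<noteq> 0 \<and> \<Sum>T *v v T = 0"
    by metis
  \<comment> \<open>Dominates, for every bad \<open>T\<close>, the sum of all generators evaluated
    at the null vector \<open>v T\<close>.\<close>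
  define D where "D = (\<Sum>T\<in>bad. \<Sum>s\<in>S. quad s (v T))"
  have "finite bad" "finite good"
    using assms(1) by (auto simp: bad_def good_def)
  have D: "(\<Sum>s\<in>S. quad s (v T)) \<le> D" if "T \<in> bad" for T
    unfolding D_def using that \<open>finite bad\<close> nonneg
    by (intro member_le_sum[where f = "\<lambda>T. \<Sum>s\<in>S. quad s (v T)"] sum_nonneg) auto
  have D0: "0 \<le> D"
    unfolding D_def using nonneg by (intro sum_nonneg) auto
  \<comment> \<open>The threshold for coefficients. On \<open>v T\<close> the generators in a bad
    \<open>T\<close> vanish and the others weigh less than \<open>c'\<close>, so \<open>B\<close> is
    at most \<open>c' * D\<close> there, below \<open>c\<close>. Adding 1 keeps the division legal
    when \<open>D\<close> is 0.\<close>
  define c' where "c' = c / (D + 1)"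
  have c': "c' > 0" "c' * D < c"
    using D0 assms(3) by (simp_all add: c'_def field_simps)
  have "\<exists>e>0. \<forall>x. e * (x \<bullet> x) \<le> quad (\<Sum>T) x" if "T \<in> good" for T
  proof -
    have "0 < quad (\<Sum>T) x" if "x \<noteq> 0" for x
      using \<open>T \<in> good\<close> that by (simp add: good_def pos_def_cone_def)
    then show ?thesis
      using pos_def_lower_bound by metis
  qed
  then obtain e where e: "\<And>T. T \<in> good \<Longrightarrow> e T > 0 \<and> (\<forall>x. e T * (x \<bullet> x) \<le> quad (\<Sum>T) x)"
    by metis
  \<comment> \<open>The inserted 1 makes the minimum meaningful even if no subset is good.\<close>
  define m where "m = Min (insert 1 (e ` good))"
  have m: "m > 0" "\<And>T. T \<in> good \<Longrightarrow> m \<le> e T"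
    using \<open>finite good\<close> e by (auto simp: m_def)
  show thesis
  proof (rule that[of "c' * m"])
    show "c' * m > 0" using c' m by simp
    fix B and x :: "real^'n"
    assume B: "B \<in> convex_cone hull S"
      and low: "\<And>z. \<lbrakk>z \<in> integral_vectors; z \<noteq> 0\<rbrakk> \<Longrightarrow> c \<le> quad B z"
    obtain l where l: "\<And>s. s \<in> S \<Longrightarrow> 0 \<le> l s" "B = (\<Sum>s\<in>S. l s *\<^sub>R s)"
      using convex_cone_hull_finite_rep[OF assms(1) B] by blast
    define T where "T = {s \<in> S. c' \<le> l s}"
    have TS: "T \<subseteq> S" by (auto simp: T_def)
    have quad_T: "quad (\<Sum>T) z = (\<Sum>s\<in>T. quad s z)" for z
      using quad_sum[where l = "\<lambda>_. 1" and T = T and x = z] by simp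
    have "T \<in> good"
    proof (rule ccontr)
      assume "T \<notin> good"
      then have T: "T \<in> bad" using TS by (simp add: good_def bad_def)
      have "(\<Sum>s\<in>T. quad s (v T)) = 0"
        using v[OF T] quad_T[of "v T"] by simp
      then have null: "quad s (v T) = 0" if "s \<in> T" for s
        using sum_nonneg_eq_0_iff[OF fin[OF TS], of "\<lambda>s. quad s (v T)"] nonneg TS that by blast
      have "quad B (v T) = (\<Sum>s\<in>S. l s * quad s (v T))"
        by (simp only: l(2) quad_sum)
      also have "\<dots> \<le> (\<Sum>s\<in>S. c' * quad s (v T))"
      proof (rule sum_mono)
        fix s assume s: "s \<in> S"
        show "l s * quad s (v T) \<le> c' * quad s (v T)"
        proof (cases "s \<in> T")
          case True
          then show ?thesis using null by simp
        next
          case False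
          then show ?thesis
            using s nonneg[OF s] by (intro mult_right_mono) (auto simp: T_def)
        qed
      qed
      also have "\<dots> = c' * (\<Sum>s\<in>S. quad s (v T))"
        by (simp add: sum_distrib_left)
      also have "\<dots> \<le> c' * D"
        using D[OF T] c'(1) by simp
      finally show False
        using low[of "v T"] v[OF T] c'(2) by simp
    qed
    \<comment> \<open>\<open>B\<close> dominates \<open>c'\<close> times the sum over
      \<open>T\<close>: coefficients in \<open>T\<close> are at least \<open>c'\<close>, and all
      remaining terms are nonnegative.\<close>
    have "c' * m * (x \<bullet> x) \<le> c' * (e T * (x \<bullet> x))"
      using c'(1) m(2)[OF \<open>T \<in> good\<close>] by (simp add: mult_right_mono)
    also have "\<dots> \<le> c' * quad (\<Sum>T) x"
      using c'(1) e[OF \<open>T \<in> good\<close>] by (intro mult_left_mono) auto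
    also have "\<dots> = (\<Sum>s\<in>T. c' * quad s x)"
      by (simp only: quad_T sum_distrib_left)
    also have "\<dots> \<le> (\<Sum>s\<in>T. l s * quad s x)"
      using nonneg TS by (intro sum_mono mult_right_mono) (auto simp: T_def)
    also have "\<dots> \<le> (\<Sum>s\<in>S. l s * quad s x)"
      using assms(1) TS l(1) nonneg by (intro sum_mono2) auto
    also have "\<dots> = quad B x"
      by (simp only: l(2) quad_sum)
    finally show "c' * m * (x \<bullet> x) \<le> quad B x" .
  qed
qed

section \<open>Integral matrices and finiteness of translates\<close>

lemma finite_vec_components:
  assumes "finite Z"
  shows "finite {v :: 'a^'n. \<forall>j. v $ j \<in> Z}"
proof (rule finite_subset)
  show "{v :: 'a^'n. \<forall>j. v $ j \<in> Z} \<subseteq> vec_lambda ` (PiE UNIV (\<lambda>_. Z))"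
  proof
    fix v :: "'a^'n" assume "v \<in> {v. \<forall>j. v $ j \<in> Z}"
    then show "v \<in> vec_lambda ` (PiE UNIV (\<lambda>_. Z))"
      by (intro image_eqI[of _ _ "vec_nth v"]) auto
  qed
qed (use assms in \<open>simp add: finite_PiE\<close>)

lemma finite_bounded_integral_matrices:
  "finite {M \<in> integral_matrices :: (real^'n^'n) set. \<forall>i j. \<bar>M $ i $ j\<bar> \<le> K}"
proof (rule finite_subset)
  let ?Z = "{z::real. z \<in> \<int> \<and> \<bar>z\<bar> \<le> K}"
  show "{M \<in> integral_matrices :: (real^'n^'n) set. \<forall>i j. \<bar>M $ i $ j\<bar> \<le> K}
      \<subseteq> {M. \<forall>i. M $ i \<in> {v. \<forall>j. v $ j \<in> ?Z}}"
    by (auto simp: integral_matrices_def)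
  show "finite {M :: real^'n^'n. \<forall>i. M $ i \<in> {v. \<forall>j. v $ j \<in> ?Z}}"
    by (intro finite_vec_components finite_abs_int_segment)
qed

text \<open>Stated for transposes because conjugating a form by M substitutes M^t into its
  argument.\<close>

lemma GL_int_inverse:
  assumes "M \<in> GL_int"
  obtains N where "N \<in> integral_matrices" "transpose N ** transpose M = mat 1"
    "transpose M ** transpose N = mat 1"
proof -
  obtain N where N: "N \<in> integral_matrices" "M ** N = mat 1" "N ** M = mat 1"
    using assms by (auto simp: GL_int_def)
  show thesis
    by (rule that[OF N(1)]) (simp_all only: matrix_transpose_mul[symmetric] N transpose_mat)
qed

text \<open>The lower bound on a translate of \<open>B\<close> passes to \<open>B\<close> on lattice
  vectors only; \<open>cone_lower_bound\<close> turns it into one on all vectors, and the upper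
  bound then limits the entries of M.\<close>

lemma cone_finite_translates:
  fixes \<sigma> :: "(real^'n^'n) set"
  assumes "rational_polyhedral_cone symmetric_lattice \<sigma>" "\<sigma> \<subseteq> rational_closure_cone" "c > 0"
  shows "finite {M \<in> GL_int. \<exists>A \<in> GL_act M \<sigma>. \<forall>x. c * (x \<bullet> x) \<le> quad A x \<and> quad A x \<le> K * (x \<bullet> x)}"
    (is "finite ?F")
proof -
  obtain S where S: "finite S" "\<sigma> = convex_cone hull S"
    using assms(1) by (auto simp: rational_polyhedral_cone_def)
  obtain d where d: "d > 0"
    "\<And>B x. \<lbrakk>B \<in> \<sigma>; \<And>z. \<lbrakk>z \<in> integral_vectors; z \<noteq> 0\<rbrakk> \<Longrightarrow> c \<le> quad B z\<rbrakk> \<Longrightarrow> d * (x \<bullet> x) \<le> quad B x"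
    using cone_lower_bound[OF S(1) _ assms(3)] assms(2) unfolding S(2) by metis
  have "?F \<subseteq> {M \<in> integral_matrices. \<forall>i j. \<bar>M $ i $ j\<bar> \<le> sqrt (K / d)}"
  proof
    fix M assume "M \<in> ?F"
    then obtain A where M: "M \<in> GL_int" and A: "A \<in> GL_act M \<sigma>"
      and bounds: "\<And>x. c * (x \<bullet> x) \<le> quad A x" "\<And>x. quad A x \<le> K * (x \<bullet> x)" by blast
    obtain B where B: "B \<in> \<sigma>" "A = M ** B ** transpose M"
      using A by (auto simp: GL_act_def)
    obtain N where N: "N \<in> integral_matrices" "transpose N ** transpose M = mat 1"
      "transpose M ** transpose N = mat 1"
      using GL_int_inverse[OF M] by blast
    have "c \<le> quad B z" if z: "z \<in> integral_vectors" "z \<noteq> 0" for z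
    proof -
      define y where "y = transpose N *v z"
      have My: "transpose M *v y = z"
        by (simp only: y_def matrix_vector_mul_assoc N matrix_vector_mul_lid)
      have "y \<in> integral_vectors"
        unfolding y_def by (rule integral_matrix_vector[OF integral_transpose[OF N(1)] z(1)])
      moreover have "y \<noteq> 0"
        using My z(2) by (metis matrix_vector_mult_0_right)
      ultimately have "1 \<le> y \<bullet> y"
        by (rule integral_norm_ge_1)
      then have "c \<le> c * (y \<bullet> y)"
        using assms(3) by simp
      also have "\<dots> \<le> quad A y"
        by (rule bounds)
      also have "\<dots> = quad B z"
        by (simp only: B(2) quad_conj My)
      finally show ?thesis .
    qed
    then have low: "d * (x \<bullet> x) \<le> quad B x" for x
      using d(2) B(1) by blast
    have "\<bar>M $ i $ j\<bar> \<le> sqrt (K / d)" for i j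
    proof -
      \<comment> \<open>This is row \<open>i\<close> of \<open>M\<close>: evaluating the translate
        at a basis vector is evaluating \<open>B\<close> at a row.\<close>
      define r where "r = transpose M *v axis i 1"
      have "d * (r \<bullet> r) \<le> quad A (axis i 1)"
        unfolding B(2) quad_conj r_def by (rule low)
      also have "\<dots> \<le> K"
        using bounds(2)[of "axis i 1"] by (simp add: inner_axis_axis)
      finally have "(norm r)\<^sup>2 \<le> K / d"
        using d(1) by (simp add: field_simps power2_norm_eq_inner)
      then have "norm r \<le> sqrt (K / d)"
        by (rule real_le_rsqrt)
      moreover have "r $ j = M $ i $ j"
        unfolding r_def matrix_vector_mult_basis by (simp add: column_def transpose_def)
      ultimately show ?thesis
        using component_le_norm_cart[of r j] by simp
    qed
    then show "M \<in> {M \<in> integral_matrices. \<forall>i j. \<bar>M $ i $ j\<bar> \<le> sqrt (K / d)}"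
      using M by (simp add: GL_int_def)
  qed
  then show ?thesis
    by (rule finite_subset) (rule finite_bounded_integral_matrices)
qed

lemma mat_1_GL_int: "mat 1 \<in> GL_int"
proof -
  have "mat 1 \<in> integral_matrices"
    by (simp add: integral_matrices_def mat_def)
  then show ?thesis
    by (auto simp: GL_int_def intro!: bexI[of _ "mat 1"])
qed

lemma GL_act_mat_1: "GL_act (mat 1) \<sigma> = \<sigma>"
  by (simp add: GL_act_def transpose_mat)

text \<open>All forms in a small ball are squeezed between the same two multiples of the standard
  form, and every cone is a translate of one of finitely many representatives.\<close>

lemma admissible_locally_finite:
  fixes \<Sigma> :: "(real^'n^'n) set set"
  assumes \<Sigma>: "admissible_decomposition \<Sigma>" and A: "A \<in> pos_def_cone"
  obtains W where "open W" "A \<in> W" "finite {\<sigma> \<in> \<Sigma>. \<sigma> \<inter> W \<noteq> {}}"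
proof -
  obtain a where a: "a > 0" "\<And>x. a * (x \<bullet> x) \<le> quad A x"
    using pos_def_lower_bound[of A] A by (auto simp: pos_def_cone_def)
  \<comment> \<open>As radius of the ball, half of the coercivity constant leaves the other half as
    a lower bound for every form in it.\<close>
  define c where "c = a / 2"
  define K where "K = norm A + c"
  have c: "c > 0" using a(1) by (simp add: c_def)
  have bounds: "c * (x \<bullet> x) \<le> quad B x \<and> quad B x \<le> K * (x \<bullet> x)" if "B \<in> ball A c" for B x
  proof -
    have "norm (B - A) * (x \<bullet> x) \<le> c * (x \<bullet> x)"
      using that by (intro mult_right_mono) (auto simp: dist_norm norm_minus_commute)
    moreover have "\<bar>quad B x - quad A x\<bar> \<le> norm (B - A) * (x \<bullet> x)"
      using abs_quad_le[of x "B - A"] by (simp add: matrix_vector_mult_diff_rdistrib inner_diff_right)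
    moreover have "quad A x \<le> norm A * (x \<bullet> x)"
      using abs_quad_le[of x A] by linarith
    moreover have "a * (x \<bullet> x) = 2 * (c * (x \<bullet> x))" "K * (x \<bullet> x) = norm A * (x \<bullet> x) + c * (x \<bullet> x)"
      by (simp_all add: K_def c_def distrib_right)
    ultimately show ?thesis
      using a(2)[of x] by linarith
  qed
  define orbit where "orbit \<sigma> = {GL_act M \<sigma> |M. M \<in> GL_int}" for \<sigma> :: "(real^'n^'n) set"
  have "finite (orbit ` \<Sigma>)"
    using \<Sigma> unfolding admissible_decomposition_def orbit_def by blast
  then obtain R where R: "finite R" "R \<subseteq> \<Sigma>" "orbit ` \<Sigma> = orbit ` R"
    by (metis finite_subset_image subset_refl)
  let ?G = "\<lambda>\<sigma>. {M \<in> GL_int. \<exists>A \<in> GL_act M \<sigma>. \<forall>x. c * (x \<bullet> x) \<le> quad A x \<and> quad A x \<le> K * (x \<bullet> x)}"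
  have "{\<sigma> \<in> \<Sigma>. \<sigma> \<inter> ball A c \<noteq> {}} \<subseteq> (\<Union>\<rho>\<in>R. (\<lambda>M. GL_act M \<rho>) ` ?G \<rho>)"
  proof
    fix \<sigma> assume "\<sigma> \<in> {\<sigma> \<in> \<Sigma>. \<sigma> \<inter> ball A c \<noteq> {}}"
    then obtain B where \<sigma>: "\<sigma> \<in> \<Sigma>" and B: "B \<in> \<sigma>" "B \<in> ball A c" by blast
    obtain \<rho> where \<rho>: "\<rho> \<in> R" "orbit \<sigma> = orbit \<rho>"
      using R(3) \<sigma> by blast
    \<comment> \<open>Equality of orbits is turned into a transporting matrix by means of membership
      of the cone in its own orbit.\<close>
    have "\<sigma> \<in> orbit \<sigma>"
      unfolding orbit_def using mat_1_GL_int GL_act_mat_1[of \<sigma>] by blast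
    then obtain M where M: "M \<in> GL_int" "\<sigma> = GL_act M \<rho>"
      using \<rho>(2) unfolding orbit_def by blast
    then have "M \<in> ?G \<rho>"
      using B bounds by blast
    then show "\<sigma> \<in> (\<Union>\<rho>\<in>R. (\<lambda>M. GL_act M \<rho>) ` ?G \<rho>)"
      using \<rho>(1) M(2) by blast
  qed
  moreover have "finite (\<Union>\<rho>\<in>R. (\<lambda>M. GL_act M \<rho>) ` ?G \<rho>)"
    using R \<Sigma> c by (intro finite_UN_I finite_imageI cone_finite_translates)
      (auto simp: admissible_decomposition_def)
  ultimately have "finite {\<sigma> \<in> \<Sigma>. \<sigma> \<inter> ball A c \<noteq> {}}"
    by (rule finite_subset)
  with c that show thesis
    by (intro that[of "ball A c"]) simp_all
qed

section \<open>Marked tropical abelian varieties and their forms\<close>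

lemma bilinear_matrix:
  fixes \<gamma> :: "real^'n \<Rightarrow> real^'n \<Rightarrow> real"
  assumes "bilinear \<gamma>"
  shows "\<gamma> x y = x \<bullet> ((\<chi> i j. \<gamma> (axis i 1) (axis j 1)) *v y)"
proof -
  have lin: "linear (\<lambda>u. \<gamma> u v)" "linear (\<gamma> u)" for u v
    using assms by (auto simp: bilinear_def)
  have expand: "(\<Sum>i\<in>UNIV. z $ i *\<^sub>R axis i 1) = z" for z :: "real^'n"
    using basis_expansion[of z] by (simp add: scalar_mult_eq_scaleR)
  have "\<gamma> x y = (\<Sum>i\<in>UNIV. x $ i * \<gamma> (axis i 1) y)"
    using linear_sum[OF lin(1), of "\<lambda>i. x $ i *\<^sub>R axis i 1" UNIV y] expand[of x]
    by (simp add: linear_scale[OF lin(1)])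
  also have "\<dots> = (\<Sum>i\<in>UNIV. x $ i * (\<Sum>j\<in>UNIV. y $ j * \<gamma> (axis i 1) (axis j 1)))"
  proof (rule sum.cong[OF refl])
    fix i
    show "x $ i * \<gamma> (axis i 1) y = x $ i * (\<Sum>j\<in>UNIV. y $ j * \<gamma> (axis i 1) (axis j 1))"
      using linear_sum[OF lin(2), of "axis i 1" "\<lambda>j. y $ j *\<^sub>R axis j 1" UNIV] expand[of y]
      by (simp add: linear_scale[OF lin(2)])
  qed
  finally show ?thesis
    by (simp add: inner_vec_def matrix_vector_mult_def mult.commute)
qed

lemma bilinear_symmetric_matrix:
  fixes \<gamma> :: "real^'n \<Rightarrow> real^'n \<Rightarrow> real"
  assumes "bilinear \<gamma>"
  obtains A where "A \<in> symmetric_matrices" "\<And>x. quad A x = \<gamma> x x"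
proof -
  define G where "G = (\<chi> i j. \<gamma> (axis i 1) (axis j 1))"
  define A where "A = (1/2) *\<^sub>R (G + transpose G)"
  show thesis
  proof (rule that[of A])
    show "A \<in> symmetric_matrices"
      by (simp add: symmetric_matrices_def A_def transpose_def vec_eq_iff)
    fix x
    have "quad (transpose G) x = quad G x"
      using dot_lmul_matrix[of x G x] by (simp add: inner_commute)
    then have "quad A x = quad G x"
      by (simp add: A_def scaleR_matrix_vector_assoc[symmetric] matrix_vector_mult_add_rdistrib
          inner_add_right del: transpose_matrix_vector)
    then show "quad A x = \<gamma> x x"
      unfolding G_def using bilinear_matrix[OF assms, of x x] by simp
  qed
qed

text \<open>Matches the matrix kernel with the radical of the polar form, by which null spaces of
  abstract forms are defined.\<close>

lemma kernel_polar:
  assumes "A \<in> symmetric_matrices"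
  shows "A *v x = 0 \<longleftrightarrow> (\<forall>y. quad A (x + y) - quad A x - quad A y = 0)"
proof -
  have "(\<forall>y. y \<bullet> (A *v x) = 0) \<longleftrightarrow> A *v x = 0"
    by (metis inner_eq_zero_iff inner_zero_right)
  then show ?thesis
    unfolding polar_form[OF assms] by simp
qed

lemma symmetric_eqI:
  assumes "A \<in> symmetric_matrices" "B \<in> symmetric_matrices" "\<And>x. quad A x = quad B x"
  shows "A = B"
proof (rule matrix_eq[THEN iffD2, rule_format])
  fix x
  have "y \<bullet> (A *v x) = y \<bullet> (B *v x)" for y
    using polar_form[OF assms(1), of x y] polar_form[OF assms(2), of x y] by (simp add: assms(3))
  then have "(A *v x - B *v x) \<bullet> (A *v x - B *v x) = 0"
    by (simp add: inner_diff_right)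
  then show "A *v x = B *v x"
    by simp
qed

text \<open>Everything is pulled back along the marking. Since it carries the standard lattice onto
  \<Lambda>, a basis of the null space with vectors rational over \<Lambda> becomes a basis of
  rational vectors.\<close>

lemma marked_tppav_form:
  fixes X :: "('v::real_vector, 'n::finite) marked_tppav"
  assumes "X \<in> marked_tppavs"
  obtains A where "A \<in> rational_closure_cone" "\<And>x. quad A x = tp_form X (tp_marking X x)"
proof -
  let ?V = "tp_space X" and ?Q = "tp_form X" and ?\<phi> = "tp_marking X"
  have tp: "is_tppav CARD('n) X" and lin: "linear ?\<phi>" and bij: "bij_betw ?\<phi> UNIV ?V"
    and lat: "?\<phi> ` integral_vectors = tp_lattice X"
    using assms by (auto simp: marked_tppavs_def is_marking_def)
  have ran: "range ?\<phi> = ?V" and inj: "inj ?\<phi>"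
    using bij by (auto simp: bij_betw_def)
  obtain \<beta> where \<beta>: "bilinear \<beta>" "\<And>x. x \<in> ?V \<Longrightarrow> ?Q x = \<beta> x x"
    using tp by (auto simp: is_tppav_def quadratic_form_on_def)
  have "bilinear (\<lambda>x y. \<beta> (?\<phi> x) (?\<phi> y))"
    using \<beta>(1) linear_compose[OF lin] by (auto simp: bilinear_def o_def)
  then obtain A where sym: "A \<in> symmetric_matrices" and "\<And>x. quad A x = \<beta> (?\<phi> x) (?\<phi> x)"
    using bilinear_symmetric_matrix by blast
  then have A: "quad A x = ?Q (?\<phi> x)" for x
    using \<beta>(2)[of "?\<phi> x"] ran by (metis rangeI)
  \<comment> \<open>The marking maps onto a subspace of \<open>'v\<close> only, so its inverse is
    replaced by a linear left inverse on all of \<open>'v\<close>.\<close>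
  obtain g where g: "linear g" "g \<circ> ?\<phi> = id"
    using linear_injective_left_inverse[OF lin inj] by blast
  then have g\<phi>: "g (?\<phi> x) = x" for x
    by (metis comp_apply id_apply)
  have null: "null_space_on ?V ?Q = ?\<phi> ` {x. A *v x = 0}"
  proof -
    have "?\<phi> x \<in> null_space_on ?V ?Q \<longleftrightarrow> A *v x = 0" for x
      unfolding kernel_polar[OF sym] null_space_on_def ran[symmetric]
      by (simp add: A linear_add[OF lin])
    moreover have "null_space_on ?V ?Q \<subseteq> range ?\<phi>"
      unfolding ran null_space_on_def by blast
    ultimately show ?thesis by blast
  qed
  obtain B where B: "B \<subseteq> {r *\<^sub>R v |r v. r \<in> \<rat> \<and> v \<in> tp_lattice X}" "independent B"
    "span B = null_space_on ?V ?Q"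
    using tp unfolding is_tppav_def by blast
  have "g ` B \<subseteq> rational_vectors"
  proof
    fix y assume "y \<in> g ` B"
    then obtain b where b: "b \<in> B" "y = g b" by blast
    then obtain r v where r: "r \<in> \<rat>" and v: "v \<in> tp_lattice X" "b = r *\<^sub>R v"
      using B(1) by blast
    then obtain z where z: "z \<in> integral_vectors" "v = ?\<phi> z"
      unfolding lat[symmetric] by blast
    have "y = r *\<^sub>R z"
      by (simp add: b(2) v(2) z(2) linear_scale[OF g(1)] g\<phi>)
    then show "y \<in> rational_vectors"
      using r z(1) Ints_subset_Rats unfolding rational_vectors_def integral_vectors_def
      by (auto intro!: Rats_mult)
  qed
  moreover have "inj_on g (span B)"
    unfolding B(3) null by (auto simp: inj_on_def g\<phi>)
  then have "independent (g ` B)"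
    using linear_independent_injective_image[OF g(1) B(2)] by blast
  moreover have "span (g ` B) = {x. A *v x = 0}"
    unfolding linear_span_image[OF g(1)] B(3) null by (simp add: image_image g\<phi>)
  moreover have "0 \<le> quad A x" for x
    using tp ran unfolding A is_tppav_def by blast
  ultimately have "A \<in> rational_closure_cone"
    unfolding rational_closure_cone_def using sym by blast
  with A that show thesis by blast
qed

lemma rational_closure_symmetric: "A \<in> rational_closure_cone \<Longrightarrow> A \<in> symmetric_matrices"
  by (simp add: rational_closure_cone_def)

lemma pullback_form_eqI:
  assumes "A \<in> symmetric_matrices" "\<And>x. quad A x = tp_form X (tp_marking X x)"
  shows "pullback_form X = A"
  unfolding pullback_form_def
proof (rule the_equality)
  show "A \<in> symmetric_matrices \<and> (\<forall>x. quad A x = tp_form X (tp_marking X x))"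
    using assms by blast
  fix B assume "B \<in> symmetric_matrices \<and> (\<forall>x. quad B x = tp_form X (tp_marking X x))"
  then show "B = A"
    using assms by (intro symmetric_eqI) simp_all
qed

lemma pullback_form:
  fixes X :: "('v::real_vector, 'n::finite) marked_tppav"
  assumes "X \<in> marked_tppavs"
  shows "pullback_form X \<in> rational_closure_cone"
    and "quad (pullback_form X) x = tp_form X (tp_marking X x)"
proof -
  obtain A where A: "A \<in> rational_closure_cone" "\<And>x. quad A x = tp_form X (tp_marking X x)"
    using marked_tppav_form[OF assms] by blast
  then have "pullback_form X = A"
    by (intro pullback_form_eqI rational_closure_symmetric)
  with A show "pullback_form X \<in> rational_closure_cone"
    "quad (pullback_form X) x = tp_form X (tp_marking X x)" by simp_all
qed

text \<open>Gives the pure objects the same shape as the full family, namely a condition on the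
  pulled back form, so that one classification serves both.\<close>

lemma marked_pure_tppavs_eq:
  "(marked_pure_tppavs :: ('v::real_vector, 'n::finite) marked_tppav set) =
     {X \<in> marked_tppavs. pullback_form X \<in> pos_def_cone}"
proof -
  have "X \<in> marked_pure_tppavs \<longleftrightarrow> pullback_form X \<in> pos_def_cone"
    if X: "X \<in> marked_tppavs" for X :: "('v, 'n) marked_tppav"
  proof -
    have lin: "linear (tp_marking X)" and bij: "bij_betw (tp_marking X) UNIV (tp_space X)"
      using X by (auto simp: marked_tppavs_def is_marking_def)
    have zero: "tp_marking X x = 0 \<longleftrightarrow> x = 0" for x
      using inj_eq[OF bij_betw_imp_inj_on[OF bij], of x 0] by (simp add: linear_0[OF lin])
    have "(\<forall>v\<in>tp_space X. v \<noteq> 0 \<longrightarrow> 0 < tp_form X v) \<longleftrightarrow>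
        (\<forall>x. x \<noteq> 0 \<longrightarrow> 0 < quad (pullback_form X) x)"
      unfolding pullback_form(2)[OF X] bij_betw_imp_surj_on[OF bij, symmetric] by (simp add: zero)
    moreover have "pullback_form X \<in> symmetric_matrices"
      using pullback_form(1)[OF X] by (rule rational_closure_symmetric)
    ultimately show ?thesis
      using X by (simp add: marked_pure_tppavs_def is_pure_tppav_def marked_tppavs_def pos_def_cone_def)
  qed
  then show ?thesis
    by (auto simp: marked_pure_tppavs_def marked_tppavs_def is_pure_tppav_def)
qed

text \<open>Markings leave no freedom: on the underlying space an isomorphism must be one marking
  after the inverse of the other. That map always respects lattices, and it respects forms exactly
  when the pullbacks agree.\<close>

lemma marked_iso_iff:
  fixes X :: "('v::real_vector, 'n::finite) marked_tppav"
    and Y :: "('w::real_vector, 'n) marked_tppav"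
  assumes X: "X \<in> marked_tppavs" and Y: "Y \<in> marked_tppavs"
  shows "marked_iso X Y \<longleftrightarrow> pullback_form X = pullback_form Y"
proof
  have lin: "linear (tp_marking X)" "linear (tp_marking Y)"
    and bij: "bij_betw (tp_marking X) UNIV (tp_space X)" "bij_betw (tp_marking Y) UNIV (tp_space Y)"
    and lat: "tp_marking X ` integral_vectors = tp_lattice X" "tp_marking Y ` integral_vectors = tp_lattice Y"
    using X Y by (auto simp: marked_tppavs_def is_marking_def)
  have ran: "range (tp_marking X) = tp_space X"
    using bij by (simp add: bij_betw_def)
  {
    assume "marked_iso X Y"
    then obtain h where h: "\<And>x. x \<in> tp_space X \<Longrightarrow> tp_form Y (h x) = tp_form X x"
      "h \<circ> tp_marking X = tp_marking Y"
      unfolding marked_iso_def by blast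
    have "quad (pullback_form Y) x = tp_form X (tp_marking X x)" for x
      unfolding pullback_form(2)[OF Y] h(2)[symmetric] using h(1) ran by auto
    then show "pullback_form X = pullback_form Y"
      by (rule pullback_form_eqI[OF rational_closure_symmetric[OF pullback_form(1)[OF Y]]])
  }
  assume eq: "pullback_form X = pullback_form Y"
  obtain g where g: "linear g" "g \<circ> tp_marking X = id"
    using linear_injective_left_inverse[OF lin(1)] bij(1) by (auto simp: bij_betw_def)
  define h where "h = tp_marking Y \<circ> g"
  have gX: "g (tp_marking X x) = x" for x
    using g(2) by (metis comp_apply id_apply)
  then have hX: "h (tp_marking X x) = tp_marking Y x" for x
    by (simp add: h_def)
  have comp: "h \<circ> tp_marking X = tp_marking Y"
    using hX by auto
  have "bij_betw h (tp_space X) (tp_space Y)"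
    unfolding h_def
  proof (rule bij_betw_trans[OF _ bij(2)])
    show "bij_betw g (tp_space X) UNIV"
      using gX unfolding ran[symmetric] by (intro bij_betw_byWitness[where f' = "tp_marking X"]) auto
  qed
  moreover have "linear h"
    unfolding h_def by (rule linear_compose[OF g(1) lin(2)])
  moreover have "h ` tp_lattice X = tp_lattice Y"
    unfolding lat[symmetric] by (simp add: image_image hX)
  moreover have "tp_form Y (h v) = tp_form X v" if "v \<in> tp_space X" for v
    using that pullback_form(2)[OF X] pullback_form(2)[OF Y] unfolding ran[symmetric]
    by (auto simp: hX eq)
  ultimately show "marked_iso X Y"
    unfolding marked_iso_def using comp by blast
qed

section \<open>The standard marked object of a form\<close>

lemma lattice_in_integral_vectors: "lattice_in UNIV (integral_vectors :: (real^'n) set)"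
proof -
  have comp: "(\<Sum>b\<in>Basis. of_int (c b) *\<^sub>R b) $ i = of_int (c (axis i 1))"
    for c :: "real^'n \<Rightarrow> int" and i
  proof -
    have "(\<Sum>b\<in>Basis. of_int (c b) *\<^sub>R b) $ i = (\<Sum>b\<in>Basis. of_int (c b) *\<^sub>R b) \<bullet> axis i 1"
      by (simp add: cart_eq_inner_axis)
    also have "\<dots> = of_int (c (axis i 1))"
      by (rule inner_sum_left_Basis) simp
    finally show ?thesis .
  qed
  have "(integral_vectors :: (real^'n) set) =
      {(\<Sum>b\<in>Basis. of_int (c b) *\<^sub>R b) |c. True}" (is "_ = ?R")
  proof (intro equalityI subsetI)
    fix x :: "real^'n" assume "x \<in> integral_vectors"
    then have floor_x: "of_int \<lfloor>x $ i\<rfloor> = x $ i" for i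
      by (simp add: integral_vectors_def)
    have "x = (\<Sum>b\<in>Basis. of_int \<lfloor>x $ axis_index b\<rfloor> *\<^sub>R b)"
      unfolding vec_eq_iff comp[of "\<lambda>b. \<lfloor>x $ axis_index b\<rfloor>"] by (simp add: floor_x)
    then show "x \<in> ?R"
      by (intro CollectI exI[of _ "\<lambda>b. \<lfloor>x $ axis_index b\<rfloor>"]) (rule conjI[OF _ TrueI])
  next
    fix x :: "real^'n" assume "x \<in> ?R"
    then show "x \<in> integral_vectors"
      using comp by (auto simp: integral_vectors_def)
  qed
  then show ?thesis
    unfolding lattice_in_def by (intro exI[of _ Basis]) (simp add: independent_Basis)
qed

lemma bilinear_quad: "bilinear (\<lambda>x y. x \<bullet> ((A :: real^'n^'n) *v y))"
  by (auto simp: bilinear_def matrix_vector_right_distrib inner_add_left inner_add_right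
      matrix_vector_mult_scaleR intro!: linearI)

lemma std_tppav:
  fixes A :: "real^'n^'n"
  assumes "A \<in> rational_closure_cone"
  shows "std_tppav A \<in> marked_tppavs" and "pullback_form (std_tppav A) = A"
proof -
  have sym: "A \<in> symmetric_matrices" and nonneg: "\<And>x. 0 \<le> quad A x"
    using assms by (auto simp: rational_closure_cone_def)
  obtain B where B: "B \<subseteq> rational_vectors" "independent B" "span B = {x. A *v x = 0}"
    using assms by (auto simp: rational_closure_cone_def)
  have "B \<subseteq> {r *\<^sub>R v |r v. r \<in> \<rat> \<and> v \<in> integral_vectors}"
  proof
    fix b assume "b \<in> B"
    then obtain d :: nat where d: "d > 0" "real d *\<^sub>R b \<in> integral_vectors"
      using rational_vector_multiple B(1) by blast
    have "b = (1 / real d) *\<^sub>R (real d *\<^sub>R b)" "1 / real d \<in> \<rat>"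
      using d(1) by simp_all
    with d(2) show "b \<in> {r *\<^sub>R v |r v. r \<in> \<rat> \<and> v \<in> integral_vectors}" by blast
  qed
  moreover have "null_space_on UNIV (quad A) = {x. A *v x = 0}"
    unfolding kernel_polar[OF sym] null_space_on_def by simp
  moreover have "quadratic_form_on UNIV (quad A)"
    unfolding quadratic_form_on_def using bilinear_quad[of A] by blast
  ultimately have "is_tppav CARD('n) (std_tppav A)"
    unfolding is_tppav_def std_tppav_def using lattice_in_integral_vectors nonneg B
    by (auto simp: dim_UNIV)
  then show "std_tppav A \<in> marked_tppavs"
    by (simp add: marked_tppavs_def is_marking_def std_tppav_def linear_id[unfolded id_def] bij_betw_def)
  show "pullback_form (std_tppav A) = A"
    by (rule pullback_form_eqI[OF sym]) (simp add: std_tppav_def)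
qed

section \<open>The tropical Siegel spaces\<close>

text \<open>A class may involve many cones but only one form, so the union in
  \<open>point_class\<close> is a single fibre of \<open>pullback_form\<close>.\<close>

lemma point_class_point:
  fixes C :: "(real^'n^'n) set set"
  assumes "facial_family C" "A \<in> \<Union>C" "\<Union>C \<subseteq> rational_closure_cone" "S \<subseteq> marked_tppavs"
  shows "point_class S (facial_family.point C A) = {X \<in> S. pullback_form X = A}"
proof -
  interpret facial_family C by fact
  have A: "A \<in> rational_closure_cone"
    using assms(2,3) by blast
  have "(\<exists>\<sigma> B. (\<sigma>, B) \<in> point A \<and> marked_iso (std_tppav B) X) \<longleftrightarrow> pullback_form X = A"
    if "X \<in> marked_tppavs" for X
  proof -
    have "(\<exists>\<sigma> B. (\<sigma>, B) \<in> point A \<and> marked_iso (std_tppav B) X) \<longleftrightarrow> marked_iso (std_tppav A) X"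
      using assms(2) by (auto simp: mem_point_iff)
    also have "\<dots> \<longleftrightarrow> pullback_form X = A"
      using marked_iso_iff[OF std_tppav(1)[OF A] that] std_tppav(2)[OF A] by auto
    finally show ?thesis .
  qed
  then show ?thesis
    unfolding point_class_def using assms(4) by blast
qed

lemma iso_classes_eq:
  fixes S :: "('v::real_vector, 'n::finite) marked_tppav set"
  assumes "S \<subseteq> marked_tppavs"
  shows "iso_classes S = (\<lambda>A. {X \<in> S. pullback_form X = A}) ` pullback_form ` S"
proof -
  have "{(X, Y). X \<in> S \<and> Y \<in> S \<and> marked_iso X Y} `` {X} = {Y \<in> S. pullback_form Y = pullback_form X}"
    if "X \<in> S" for X
    using that assms marked_iso_iff by fastforce
  then show ?thesis
    unfolding iso_classes_def quotient_def by auto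
qed

text \<open>Restricted to objects inside \<open>real^'n\<close>, where the standard object makes
  every fibre of \<open>pullback_form\<close> nonempty. A type \<open>'v\<close> without
  g-dimensional subspaces would give only empty fibres, and injectivity would fail as soon as there
  are two points.\<close>

lemma bij_betw_point_class:
  fixes C :: "(real^'n^'n) set set"
  assumes C: "facial_family C" "\<Union>C \<subseteq> rational_closure_cone"
    and S: "S = {X \<in> marked_tppavs :: (real^'n, 'n) marked_tppav set. pullback_form X \<in> \<Union>C}"
  shows "bij_betw (point_class S) (topspace (glued_space C (\<lambda>\<sigma>. \<sigma>) (face_inclusions C))) (iso_classes S)"
proof -
  interpret facial_family C by fact
  have sub: "S \<subseteq> marked_tppavs" using S by blast
  have std: "std_tppav A \<in> S" "pullback_form (std_tppav A) = A" if "A \<in> \<Union>C" for A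
  proof -
    have "A \<in> rational_closure_cone" using that C(2) by blast
    then show "std_tppav A \<in> S" "pullback_form (std_tppav A) = A"
      using that std_tppav[of A] unfolding S by auto
  qed
  have cls: "point_class S (point A) = {X \<in> S. pullback_form X = A}" if "A \<in> \<Union>C" for A
    using point_class_point C sub that by blast
  have img: "pullback_form ` S = \<Union>C"
  proof (intro equalityI subsetI)
    fix A assume "A \<in> \<Union>C"
    then show "A \<in> pullback_form ` S"
      using std[of A] by (intro image_eqI[of _ _ "std_tppav A"]) simp_all
  qed (use S in blast)
  show ?thesis
    unfolding bij_betw_def topspace_glued
  proof
    show "inj_on (point_class S) (point ` \<Union>C)"
    proof (rule inj_onI)
      fix p q assume "p \<in> point ` \<Union>C" "q \<in> point ` \<Union>C" and eq: "point_class S p = point_class S q"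
      then obtain A B where A: "A \<in> \<Union>C" "p = point A" and B: "B \<in> \<Union>C" "q = point B" by blast
      have "{X \<in> S. pullback_form X = A} = {X \<in> S. pullback_form X = B}"
        using eq cls[OF A(1)] cls[OF B(1)] by (simp only: A B)
      then have "std_tppav A \<in> {X \<in> S. pullback_form X = B}"
        using std[OF A(1)] by blast
      then show "p = q"
        using std(2)[OF A(1)] A(2) B(2) by simp
    qed
    show "point_class S ` point ` \<Union>C = iso_classes S"
      unfolding iso_classes_eq[OF sub] img image_image by (rule image_cong[OF refl cls])
  qed
qed

text \<open>The complement to the bijection for objects in an arbitrary real vector space: the
  pulled back form determines the point.\<close>

lemma ex1_point_class:
  fixes C :: "(real^'n^'n) set set"
  assumes C: "facial_family C" "\<Union>C \<subseteq> rational_closure_cone"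
    and S: "S = {X \<in> marked_tppavs :: ('v::real_vector, 'n) marked_tppav set. pullback_form X \<in> \<Union>C}"
    and X: "X \<in> S"
  shows "\<exists>!p. p \<in> topspace (glued_space C (\<lambda>\<sigma>. \<sigma>) (face_inclusions C)) \<and> X \<in> point_class S p"
proof -
  interpret facial_family C by fact
  have sub: "S \<subseteq> marked_tppavs" unfolding S by blast
  have cls: "point_class S (point A) = {X \<in> S. pullback_form X = A}" if "A \<in> \<Union>C" for A
    by (rule point_class_point[OF C(1) that C(2) sub])
  show ?thesis
    unfolding topspace_glued
  proof (rule ex1I[of _ "point (pullback_form X)"])
    have U: "pullback_form X \<in> \<Union>C" using X S by blast
    then show "point (pullback_form X) \<in> point ` \<Union>C \<and> X \<in> point_class S (point (pullback_form X))"
      using X cls[OF U] by auto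
    fix p assume p: "p \<in> point ` \<Union>C \<and> X \<in> point_class S p"
    then obtain A where A: "A \<in> \<Union>C" "p = point A" by blast
    then show "p = point (pullback_form X)"
      using p cls[OF A(1)] by simp
  qed
qed

section \<open>Positive definite parts of cones\<close>

text \<open>Convexity is what makes the slice of a face a face of the sliced cone.\<close>

lemma convex_pos_def_cone: "convex pos_def_cone"
proof (rule convexI)
  fix A B :: "real^'n^'n" and u v :: real
  assume A: "A \<in> pos_def_cone" and B: "B \<in> pos_def_cone" and uv: "0 \<le> u" "0 \<le> v" "u + v = 1"
  have "0 < quad (u *\<^sub>R A + v *\<^sub>R B) x" if "x \<noteq> 0" for x
  proof -
    have "0 < quad A x" "0 < quad B x"
      using A B that by (auto simp: pos_def_cone_def)
    then have "0 < u * quad A x + v * quad B x"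
      using uv by (cases "u = 0") (auto intro: add_pos_nonneg)
    then show ?thesis
      by (simp add: quad_eq_inner inner_add_right)
  qed
  moreover have "u *\<^sub>R A + v *\<^sub>R B \<in> symmetric_matrices"
    using A B by (simp add: pos_def_cone_def symmetric_matrices_def transpose_def vec_eq_iff)
  ultimately show "u *\<^sub>R A + v *\<^sub>R B \<in> pos_def_cone"
    by (simp add: pos_def_cone_def)
qed

text \<open>The faces removed are those without positive definite forms. They cover every degenerate
  form A of the cone: for a null vector z of A, the forms vanishing at z lie on a supporting
  hyperplane, because all forms of the cone are nonnegative at z.\<close>

lemma ideal_cone_pos_def:
  fixes \<sigma> :: "(real^'n^'n) set"
  assumes poly: "rational_polyhedral_cone symmetric_lattice \<sigma>" and sub: "\<sigma> \<subseteq> rational_closure_cone"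
    and ne: "\<sigma> \<inter> pos_def_cone \<noteq> {}"
  shows "ideal_cone symmetric_lattice (\<sigma> \<inter> pos_def_cone)"
proof -
  have conv: "convex \<sigma>"
    using poly by (auto simp: rational_polyhedral_cone_def convex_convex_cone_hull)
  define F where "F = {T. T face_of \<sigma> \<and> T \<inter> pos_def_cone = {}}"
  have "A \<in> \<Union>F" if A: "A \<in> \<sigma>" "A \<notin> pos_def_cone" for A
  proof -
    obtain z where z: "z \<noteq> 0" "A *v z = 0"
      using integral_kernel_vector A sub by (metis subsetD)
    have "\<sigma> \<inter> {B. square_matrix z \<bullet> B = 0} face_of \<sigma>"
    proof (rule face_of_Int_supporting_hyperplane_ge[OF conv])
      fix B assume "B \<in> \<sigma>"
      then have "0 \<le> quad B z"
        using sub by (auto simp: rational_closure_cone_def)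
      then show "0 \<le> square_matrix z \<bullet> B"
        by (simp only: quad_eq_inner)
    qed
    moreover have "\<sigma> \<inter> {B. square_matrix z \<bullet> B = 0} \<inter> pos_def_cone = {}"
      using z(1) by (auto simp: quad_eq_inner[symmetric] pos_def_cone_def)
    moreover have "A \<in> \<sigma> \<inter> {B. square_matrix z \<bullet> B = 0}"
      using A(1) z(2) by (simp add: quad_eq_inner[symmetric])
    ultimately show ?thesis
      unfolding F_def by blast
  qed
  then have "\<sigma> \<inter> pos_def_cone = \<sigma> - \<Union>F"
    unfolding F_def by blast
  then show ?thesis
    unfolding ideal_cone_def
    by (intro conjI ne exI[of _ \<sigma>] exI[of _ F] poly) (simp_all add: F_def)
qed

section \<open>The two Siegel spaces of a fixed decomposition\<close>

context
  fixes \<Sigma> :: "(real^'n^'n) set set"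
  assumes \<Sigma>: "admissible_decomposition \<Sigma>"
begin

lemma admissible_cone:
  assumes "\<sigma> \<in> \<Sigma>"
  shows "rational_polyhedral_cone symmetric_lattice \<sigma>" "\<sigma> \<subseteq> rational_closure_cone"
    "polyhedron \<sigma>" "closed \<sigma>" "\<sigma> \<noteq> {}"
proof -
  show poly: "rational_polyhedral_cone symmetric_lattice \<sigma>" and "\<sigma> \<subseteq> rational_closure_cone"
    using \<Sigma> assms by (auto simp: admissible_decomposition_def)
  then show "polyhedron \<sigma>" "\<sigma> \<noteq> {}"
    by (auto simp: rational_polyhedral_cone_def polyhedron_convex_cone_hull convex_cone_hull_nonempty)
  then show "closed \<sigma>"
    by (simp add: polyhedron_imp_closed)
qed

lemma admissible_Union: "\<Union>\<Sigma> = rational_closure_cone"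
  using \<Sigma> by (simp add: admissible_decomposition_def)

lemma facial_family_admissible: "facial_family \<Sigma>"
proof
  show face: "\<sigma> \<inter> \<tau> face_of \<sigma>" if "\<sigma> \<in> \<Sigma>" "\<tau> \<in> \<Sigma>" for \<sigma> \<tau>
    using \<Sigma> that by (auto simp: admissible_decomposition_def)
  have faces: "F \<in> \<Sigma>" if "\<sigma> \<in> \<Sigma>" "F face_of \<sigma>" "F \<noteq> {}" for F \<sigma>
    using \<Sigma> that by (auto simp: admissible_decomposition_def)
  show "\<sigma> \<inter> \<tau> \<in> \<Sigma>" if "\<sigma> \<in> \<Sigma>" "\<tau> \<in> \<Sigma>" "A \<in> \<sigma>" "A \<in> \<tau>" for \<sigma> \<tau> A
    using faces[OF that(1) face[OF that(1,2)]] that(3,4) by blast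
  fix A assume "A \<in> \<Union>\<Sigma>"
  then obtain \<sigma> where \<sigma>: "\<sigma> \<in> \<Sigma>" "A \<in> \<sigma>" by blast
  then obtain F where "F face_of \<sigma>" "A \<in> rel_interior F"
    using polyhedron_rel_interior_face admissible_cone(3) by metis
  then show "\<exists>\<tau>\<in>\<Sigma>. A \<in> rel_interior \<tau>"
    using faces[OF \<sigma>(1)] by (metis emptyE rel_interior_subset subsetD)
qed

text \<open>Inside a cone symmetry is automatic, so the slice is by a set open among all matrices,
  as the relative interior argument requires.\<close>

lemma Int_pos_def_cone:
  assumes "\<sigma> \<in> \<Sigma>"
  shows "\<sigma> \<inter> pos_def_cone = \<sigma> \<inter> {A. \<forall>x. x \<noteq> 0 \<longrightarrow> 0 < quad A x}"
  using admissible_cone(2)[OF assms] by (auto simp: pos_def_cone_def rational_closure_cone_def)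

lemma pure_Union: "\<Union>(pure_restriction \<Sigma>) = pos_def_cone"
proof -
  have "\<Union>(pure_restriction \<Sigma>) = \<Union>\<Sigma> \<inter> pos_def_cone"
    unfolding pure_restriction_def by blast
  then show ?thesis
    using admissible_Union pos_def_subset by blast
qed

text \<open>Common faces survive slicing by a convex set, and relative interior points survive
  slicing by an open one; nonempty slices are members by construction.\<close>

lemma facial_family_pure: "facial_family (pure_restriction \<Sigma>)"
proof
  interpret facial_family \<Sigma> by (rule facial_family_admissible)
  fix \<sigma> \<tau> assume "\<sigma> \<in> pure_restriction \<Sigma>" "\<tau> \<in> pure_restriction \<Sigma>"
  then obtain \<sigma>' \<tau>' where \<sigma>': "\<sigma>' \<in> \<Sigma>" "\<sigma> = \<sigma>' \<inter> pos_def_cone"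
    and \<tau>': "\<tau>' \<in> \<Sigma>" "\<tau> = \<tau>' \<inter> pos_def_cone"
    unfolding pure_restriction_def by blast
  have eq: "\<sigma> \<inter> \<tau> = \<sigma>' \<inter> \<tau>' \<inter> pos_def_cone"
    using \<sigma>' \<tau>' by blast
  show "\<sigma> \<inter> \<tau> face_of \<sigma>"
    using face_of_slice[OF Int_face[OF \<sigma>'(1) \<tau>'(1)] convex_pos_def_cone]
    by (simp only: eq \<sigma>'(2)[symmetric])
  fix A assume A: "A \<in> \<sigma>" "A \<in> \<tau>"
  then have "\<sigma>' \<inter> \<tau>' \<in> \<Sigma>"
    using Int_mem \<sigma>' \<tau>' by blast
  then show "\<sigma> \<inter> \<tau> \<in> pure_restriction \<Sigma>"
    using A eq unfolding pure_restriction_def by blast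
next
  interpret facial_family \<Sigma> by (rule facial_family_admissible)
  fix A assume "A \<in> \<Union>(pure_restriction \<Sigma>)"
  then have A: "A \<in> pos_def_cone" "A \<in> \<Union>\<Sigma>"
    unfolding pure_restriction_def by blast+
  then obtain \<tau> where \<tau>: "\<tau> \<in> \<Sigma>" "A \<in> rel_interior \<tau>"
    using ex_rel_interior by blast
  have "A \<in> rel_interior (\<tau> \<inter> pos_def_cone)"
    unfolding Int_pos_def_cone[OF \<tau>(1)]
    using \<tau>(2) A(1) by (intro rel_interior_Int_open_mem open_pos_def) (auto simp: pos_def_cone_def)
  moreover have "\<tau> \<inter> pos_def_cone \<in> pure_restriction \<Sigma>"
    using \<tau> A(1) rel_interior_subset unfolding pure_restriction_def by blast
  ultimately show "\<exists>\<tau>\<in>pure_restriction \<Sigma>. A \<in> rel_interior \<tau>" by blast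
qed

interpretation full: facial_family \<Sigma>
  by (rule facial_family_admissible)

interpretation pure: facial_family "pure_restriction \<Sigma>"
  by (rule facial_family_pure)

text \<open>The description is well defined because the standard object inhabits the class and all
  its members pull back to the same form.\<close>

lemma siegel_map_point:
  assumes "A \<in> rational_closure_cone"
  shows "siegel_map (full.point A) = A"
proof -
  have "point_class (marked_tppavs :: (real^'n, 'n) marked_tppav set) (full.point A)
      = {X \<in> marked_tppavs. pullback_form X = A}"
    using assms by (intro point_class_point facial_family_admissible) (simp_all add: admissible_Union)
  moreover have "std_tppav A \<in> \<dots>"
    using std_tppav[OF assms] by simp
  ultimately show ?thesis
    unfolding siegel_map_def by (intro the_equality) auto
qed

text \<open>The choice of cone does not matter: every cone through A yields the same class in the
  full space.\<close>

lemma pure_inclusion_point: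
  assumes "A \<in> pos_def_cone"
  shows "pure_inclusion \<Sigma> (pure.point A) = full.point A"
  unfolding pure_inclusion_def tropical_siegel_def full.topspace_glued
proof (rule the_equality)
  obtain \<sigma> where \<sigma>: "\<sigma> \<in> \<Sigma>" "A \<in> \<sigma>"
    using assms pos_def_subset admissible_Union by blast
  moreover have "\<sigma> \<inter> pos_def_cone \<in> pure_restriction \<Sigma>"
    unfolding pure_restriction_def using assms \<sigma> by blast
  ultimately have "(\<sigma> \<inter> pos_def_cone, A) \<in> pure.point A" "(\<sigma>, A) \<in> full.point A"
    using assms by (simp_all add: pure.mem_point_iff full.mem_point_iff)
  then show "full.point A \<in> full.point ` \<Union>\<Sigma> \<and>
      (\<exists>\<sigma>\<in>\<Sigma>. \<exists>B. (\<sigma> \<inter> pos_def_cone, B) \<in> pure.point A \<and> (\<sigma>, B) \<in> full.point A)"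
    using \<sigma> by blast
qed (auto simp: pure.mem_point_iff full.mem_point_iff)

lemma siegel_map_pure_inclusion_point:
  "A \<in> pos_def_cone \<Longrightarrow> siegel_map (pure_inclusion \<Sigma> (pure.point A)) = A"
  using pure_inclusion_point siegel_map_point pos_def_subset by auto

lemma stacky_fan_tropical_siegel:
  "stacky_fan symmetric_lattice \<Sigma> (\<lambda>\<sigma>. \<sigma>) (face_inclusions \<Sigma>)"
proof -
  have "ideal_cone symmetric_lattice \<sigma>" if "\<sigma> \<in> \<Sigma>" for \<sigma>
    unfolding ideal_cone_def using admissible_cone(1,5)[OF that]
    by (intro conjI exI[of _ \<sigma>] exI[of _ "{}"]) simp_all
  then show ?thesis
    unfolding stacky_fan_def using full.ideal_stacky_fanI admissible_cone(4) by blast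
qed

lemma ideal_stacky_fan_pure_tropical_siegel:
  "ideal_stacky_fan symmetric_lattice (pure_restriction \<Sigma>) (\<lambda>\<sigma>. \<sigma>)
     (face_inclusions (pure_restriction \<Sigma>))"
proof (rule pure.ideal_stacky_fanI)
  fix \<sigma> assume "\<sigma> \<in> pure_restriction \<Sigma>"
  then show "ideal_cone symmetric_lattice \<sigma>"
    unfolding pure_restriction_def using ideal_cone_pos_def admissible_cone(1,2) by blast
qed

lemma homeomorphic_map_pure:
  "homeomorphic_map (pure_tropical_siegel \<Sigma>) (top_of_set pos_def_cone) (siegel_map \<circ> pure_inclusion \<Sigma>)"
  unfolding pure_tropical_siegel_def pure_Union[symmetric]
proof (rule pure.homeomorphic_map_glued, unfold pure_Union)
  fix A :: "real^'n^'n" assume A: "A \<in> pos_def_cone"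
  then show "(siegel_map \<circ> pure_inclusion \<Sigma>) (pure.point A) = A"
    by (simp add: siegel_map_pure_inclusion_point)
  obtain W where W: "open W" "A \<in> W" "finite {\<sigma> \<in> \<Sigma>. \<sigma> \<inter> W \<noteq> {}}"
    using admissible_locally_finite[OF \<Sigma> A] by blast
  have "{\<sigma> \<in> pure_restriction \<Sigma>. \<sigma> \<inter> W \<noteq> {}} \<subseteq> (\<lambda>\<sigma>. \<sigma> \<inter> pos_def_cone) ` {\<sigma> \<in> \<Sigma>. \<sigma> \<inter> W \<noteq> {}}"
    unfolding pure_restriction_def by blast
  then have "finite {\<sigma> \<in> pure_restriction \<Sigma>. \<sigma> \<inter> W \<noteq> {}}"
    by (rule finite_subset) (intro finite_imageI W)
  with W(1,2) show "\<exists>W. open W \<and> A \<in> W \<and> finite {\<sigma> \<in> pure_restriction \<Sigma>. \<sigma> \<inter> W \<noteq> {}}"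
    by blast
next
  fix \<sigma> assume "\<sigma> \<in> pure_restriction \<Sigma>"
  then obtain \<sigma>' where "\<sigma>' \<in> \<Sigma>" "\<sigma> = \<sigma>' \<inter> pos_def_cone"
    unfolding pure_restriction_def by blast
  then show "closedin (top_of_set pos_def_cone) \<sigma>"
    using admissible_cone(4) by (metis closedin_closed_Int Int_commute)
qed

end

theorem proposition5p3p4:
  fixes \<Sigma> :: "(real^'n^'n) set set"
  assumes "admissible_decomposition \<Sigma>"
  shows
    "(stacky_fan symmetric_lattice \<Sigma> (\<lambda>\<sigma>. \<sigma>) (face_inclusions \<Sigma>) \<and>
      bij_betw (point_class (marked_tppavs :: (real^'n, 'n) marked_tppav set))
        (topspace (tropical_siegel \<Sigma>)) (iso_classes marked_tppavs) \<and>
      (\<forall>X \<in> (marked_tppavs :: ('v::real_vector, 'n) marked_tppav set).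
         \<exists>!p. p \<in> topspace (tropical_siegel \<Sigma>) \<and> X \<in> point_class marked_tppavs p)) \<and>
     (ideal_stacky_fan symmetric_lattice (pure_restriction \<Sigma>) (\<lambda>\<sigma>. \<sigma>)
        (face_inclusions (pure_restriction \<Sigma>)) \<and>
      bij_betw (point_class (marked_pure_tppavs :: (real^'n, 'n) marked_tppav set))
        (topspace (pure_tropical_siegel \<Sigma>)) (iso_classes marked_pure_tppavs) \<and>
      (\<forall>X \<in> (marked_pure_tppavs :: ('v, 'n) marked_tppav set).
         \<exists>!p. p \<in> topspace (pure_tropical_siegel \<Sigma>) \<and> X \<in> point_class marked_pure_tppavs p)) \<and>
     ((\<forall>p \<in> topspace (tropical_siegel \<Sigma>).
         \<forall>X \<in> point_class (marked_tppavs :: ('v, 'n) marked_tppav set) p.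
           siegel_map p = pullback_form X) \<and>
      continuous_map (tropical_siegel \<Sigma>) (top_of_set rational_closure_cone) siegel_map \<and>
      bij_betw siegel_map (topspace (tropical_siegel \<Sigma>)) rational_closure_cone) \<and>
     ((\<forall>p \<in> topspace (pure_tropical_siegel \<Sigma>).
         \<forall>X \<in> point_class (marked_pure_tppavs :: ('v, 'n) marked_tppav set) p.
           siegel_map (pure_inclusion \<Sigma> p) = pullback_form X) \<and>
      homeomorphic_map (pure_tropical_siegel \<Sigma>) (top_of_set pos_def_cone)
        (siegel_map \<circ> pure_inclusion \<Sigma>))"
proof -
  note full = facial_family_admissible[OF assms] and pure = facial_family_pure[OF assms]
  note full_Union = admissible_Union[OF assms] and pure_Union = pure_Union[OF assms]
  have full_sub: "\<Union>\<Sigma> \<subseteq> rational_closure_cone" and pure_sub: "\<Union>(pure_restriction \<Sigma>) \<subseteq> rational_closure_cone"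
    using full_Union pure_Union pos_def_subset by simp_all
  \<comment> \<open>Stated over a fresh type \<open>'w\<close>, to be used both at
    \<open>real^'n\<close> for the bijection and at \<open>'v\<close> for unique existence.\<close>
  have full_tppavs: "(marked_tppavs :: ('w::real_vector, 'n) marked_tppav set) =
      {X \<in> marked_tppavs. pullback_form X \<in> \<Union>\<Sigma>}"
    using pullback_form(1) full_Union by auto
  have pure_tppavs: "(marked_pure_tppavs :: ('w::real_vector, 'n) marked_tppav set) =
      {X \<in> marked_tppavs. pullback_form X \<in> \<Union>(pure_restriction \<Sigma>)}"
    unfolding pure_Union by (rule marked_pure_tppavs_eq)
  have siegel: "siegel_map (facial_family.point \<Sigma> A) = A" if "A \<in> \<Union>\<Sigma>" for A
    using siegel_map_point[OF assms] that full_Union by blast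
  have full_Phi: "siegel_map p = pullback_form X"
    if p: "p \<in> topspace (tropical_siegel \<Sigma>)"
      and X: "X \<in> point_class (marked_tppavs :: ('v, 'n) marked_tppav set) p"
    for p X
  proof -
    obtain A where A: "A \<in> \<Union>\<Sigma>" "p = facial_family.point \<Sigma> A"
      using p unfolding tropical_siegel_def facial_family.topspace_glued[OF full] by blast
    have "point_class (marked_tppavs :: ('v, 'n) marked_tppav set) p = {X \<in> marked_tppavs. pullback_form X = A}"
      unfolding A(2) by (rule point_class_point[OF full A(1) full_sub subset_refl])
    then show ?thesis
      using X siegel[OF A(1)] A(2) by auto
  qed
  have pure_Phi: "siegel_map (pure_inclusion \<Sigma> p) = pullback_form X"
    if p: "p \<in> topspace (pure_tropical_siegel \<Sigma>)"
      and X: "X \<in> point_class (marked_pure_tppavs :: ('v, 'n) marked_tppav set) p"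
    for p X
  proof -
    obtain A where A: "A \<in> \<Union>(pure_restriction \<Sigma>)" "p = facial_family.point (pure_restriction \<Sigma>) A"
      using p unfolding pure_tropical_siegel_def facial_family.topspace_glued[OF pure] by blast
    have "point_class (marked_pure_tppavs :: ('v, 'n) marked_tppav set) p =
        {X \<in> marked_pure_tppavs. pullback_form X = A}"
      unfolding A(2) by (rule point_class_point[OF pure A(1) pure_sub]) (auto simp: marked_pure_tppavs_eq)
    then show ?thesis
      using X siegel_map_pure_inclusion_point[OF assms, of A] A pure_Union by auto
  qed
  show ?thesis
  proof (intro conjI ballI)
    show "stacky_fan symmetric_lattice \<Sigma> (\<lambda>\<sigma>. \<sigma>) (face_inclusions \<Sigma>)"
      by (rule stacky_fan_tropical_siegel[OF assms])
    show "ideal_stacky_fan symmetric_lattice (pure_restriction \<Sigma>) (\<lambda>\<sigma>. \<sigma>)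
        (face_inclusions (pure_restriction \<Sigma>))"
      by (rule ideal_stacky_fan_pure_tropical_siegel[OF assms])
    show "bij_betw (point_class (marked_tppavs :: (real^'n, 'n) marked_tppav set))
        (topspace (tropical_siegel \<Sigma>)) (iso_classes marked_tppavs)"
      unfolding tropical_siegel_def by (rule bij_betw_point_class[OF full full_sub full_tppavs])
    show "bij_betw (point_class (marked_pure_tppavs :: (real^'n, 'n) marked_tppav set))
        (topspace (pure_tropical_siegel \<Sigma>)) (iso_classes marked_pure_tppavs)"
      unfolding pure_tropical_siegel_def by (rule bij_betw_point_class[OF pure pure_sub pure_tppavs])
    show "\<exists>!p. p \<in> topspace (tropical_siegel \<Sigma>) \<and> X \<in> point_class marked_tppavs p"
      if "X \<in> marked_tppavs" for X :: "('v, 'n) marked_tppav"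
      unfolding tropical_siegel_def by (rule ex1_point_class[OF full full_sub full_tppavs that])
    show "\<exists>!p. p \<in> topspace (pure_tropical_siegel \<Sigma>) \<and> X \<in> point_class marked_pure_tppavs p"
      if "X \<in> marked_pure_tppavs" for X :: "('v, 'n) marked_tppav"
      unfolding pure_tropical_siegel_def by (rule ex1_point_class[OF pure pure_sub pure_tppavs that])
    show "continuous_map (tropical_siegel \<Sigma>) (top_of_set rational_closure_cone) siegel_map"
      unfolding tropical_siegel_def full_Union[symmetric]
      by (rule facial_family.continuous_map_glued[OF full siegel])
    show "bij_betw siegel_map (topspace (tropical_siegel \<Sigma>)) rational_closure_cone"
      unfolding tropical_siegel_def full_Union[symmetric]
      by (rule facial_family.bij_betw_glued[OF full siegel])
    show "homeomorphic_map (pure_tropical_siegel \<Sigma>) (top_of_set pos_def_cone)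
        (siegel_map \<circ> pure_inclusion \<Sigma>)"
      by (rule homeomorphic_map_pure[OF assms])
  qed (use full_Phi pure_Phi in blast)+
qed

end
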